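(* Let $G$ be a finite simple undirected planar graph and $k$ an integer with $1 \leq k \leq \omega(G) \leq 4$. Then $\mathsf{TS}_k(G)$ is planar.
   Context: $\omega(G)$ is the maximum clique size of $G$; a $k$-clique is a set of $k$ pairwise adjacent vertices. $\mathsf{TS}_k(G)$ is the graph on the $k$-cliques of $G$ where $C, C'$ are adjacent iff there are vertices $u,v$ with $C \setminus C' = \{u\}$, $C' \setminus C = \{v\}$ and $uv \in E(G)$. *)

theory Defs
  imports "HOL-Analysis.Analysis"
begin

definition simple_graph :: "'a set \<Rightarrow> 'a set set \<Rightarrow> bool" where
  "simple_graph V E \<longleftrightarrow> finite V \<and>
     (\<forall>e\<in>E. \<exists>u v. u \<in> V \<and> v \<in> V \<and> u \<noteq> v \<and> e = {u, v})"

definition planar :: "'a set \<Rightarrow> 'a set set \<Rightarrow> bool" where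
  "planar V E \<longleftrightarrow> (\<exists>(f :: 'a \<Rightarrow> complex) (\<gamma> :: 'a set \<Rightarrow> real \<Rightarrow> complex).
     inj_on f V \<and>
     (\<forall>e\<in>E. arc (\<gamma> e) \<and> {pathstart (\<gamma> e), pathfinish (\<gamma> e)} = f ` e \<and>
              path_image (\<gamma> e) \<inter> f ` V = f ` e) \<and>
     (\<forall>e\<in>E. \<forall>e'\<in>E. e \<noteq> e' \<longrightarrow> path_image (\<gamma> e) \<inter> path_image (\<gamma> e') \<subseteq> f ` (e \<inter> e')))"

definition clique :: "'a set \<Rightarrow> 'a set set \<Rightarrow> 'a set \<Rightarrow> bool" where
  "clique V E C \<longleftrightarrow> C \<subseteq> V \<and> (\<forall>u\<in>C. \<forall>v\<in>C. u \<noteq> v \<longrightarrow> {u, v} \<in> E)"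

definition k_cliques :: "'a set \<Rightarrow> 'a set set \<Rightarrow> nat \<Rightarrow> 'a set set" where
  "k_cliques V E k = {C. clique V E C \<and> card C = k}"

definition clique_number :: "'a set \<Rightarrow> 'a set set \<Rightarrow> nat" where
  "clique_number V E = Max {card C | C. clique V E C}"

definition TS_edges :: "'a set \<Rightarrow> 'a set set \<Rightarrow> nat \<Rightarrow> 'a set set set" where
  "TS_edges V E k = {{C, C'} | C C'. C \<in> k_cliques V E k \<and> C' \<in> k_cliques V E k \<and>
      (\<exists>u v. C - C' = {u} \<and> C' - C = {v} \<and> {u, v} \<in> E)}"

end

(*
The cases k = 1 and k = 4 are immediate: TS_1(G) is a copy of G, and an edge of TS_4(G) would yield
a 5-clique. For the other two, a planar drawing is first normalised so that around each vertex there
is a disc which every incident edge leaves along a radius; what remains of the edges are pairwise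
disjoint "middle arcs".

By the Jordan curve theorem, two neighbours x, y of a whose radii at a lie in different sectors of the
corner b, a, c are separated by the triangle abc; in particular they are not adjacent.

k = 2: an edge {uv, uw} of TS_2(G) comes from a triangle uvw; draw it as the chord of the disc at u
between the radii of uv and uw. Crossing chords would come from two triangles that the separation
property excludes. Finally collapse every middle arc to a point by a continuous map of the plane that
is otherwise injective; the point is the vertex uv of TS_2(G).

k = 3: TS_3(G) is a union of K4's, one for each 4-clique of G, and any two of them share at most one
vertex. The separation property shows that the triangle abc separates any two common neighbours of
a, b, c. An extremal argument then gives, in every nonempty family of 4-cliques, one that shares at
most one of its triangles with other members, so TS_3(G) is drawn with straight segments by attaching
the K4's one at a time, each inside a thin cone at the vertex where it is attached.
*)

theory Submission
  imports Defs "HOL-Complex_Analysis.Riemann_Mapping"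
begin

section \<open>Collapsing arcs\<close>

text \<open>Planarity is given by arbitrary arcs, which may spiral around their ends, so the edges
  at a vertex have no directions to compare. The discs repair this: the ends of the edges at a
  vertex become points of one circle, no three of them collinear, and their cyclic order is read off
  from signs of areas. The basic contradiction is always the same: signs at a corner of a triangle
  put two vertices on different sides of it, while an edge that misses the triangle puts them on the
  same side. For k = 2 the obstacle is that the vertex uv has to be present in the disc at u and in
  the disc at v at once; this is why the middle arc must shrink to a point. The chords survive,
  because they touch middle arcs only at their ends. For k = 3 the drawing of G serves only to find
  an order of the 4-cliques. Distinct 4-cliques have at most three common vertices, hence at most
  one common triangle, and a K4 that is attached at a single vertex can be made as small and as thin
  as desired.\<close>

lemma connected_arc_minus_start:
  fixes g :: "real \<Rightarrow> 'a :: t2_space"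
  assumes "arc g"
  shows "connected (path_image g - {pathstart g})"
proof -
  have "g ` ({0..1} - {0}) = g ` {0..1} - g ` {0}"
    using assms by (intro inj_on_image_set_diff[of g "{0..1}"]) (auto simp: arc_def)
  moreover have "{0..1} - {0} = {0<..(1::real)}" by auto
  ultimately have "path_image g - {pathstart g} = g ` {0<..1}"
    by (simp add: path_image_def pathstart_def)
  moreover have "continuous_on {0<..1} g"
    using assms by (auto simp: arc_def path_def elim: continuous_on_subset)
  ultimately show ?thesis by (simp add: connected_continuous_image)
qed

text \<open>Inversion at an endpoint of the arc turns the complement of the arc, together with infinity, into a
  simply connected open set, which is homeomorphic to the plane. Inverting back sends the arc to \<open>0\<close>.\<close>

lemma arc_collapse:
  fixes g :: "real \<Rightarrow> complex"
  assumes "arc g"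
  obtains q :: "complex \<Rightarrow> complex"
  where "continuous_on UNIV q"
    and "\<And>z w. q z = q w \<longleftrightarrow> z = w \<or> z \<in> path_image g \<and> w \<in> path_image g"
proof -
  define \<Gamma> where "\<Gamma> = path_image g"
  define a where "a = pathstart g"
  \<comment> \<open>In the coordinate \<open>w = inverse (z - a)\<close> the value \<open>0\<close>
    stands for infinity. It is put into \<open>U\<close> by hand: as \<open>inverse 0 = 0\<close>,
    the second condition at \<open>w = 0\<close> would test \<open>a\<close> itself, which is on the
    arc.\<close>
  define U where "U = {w. w = 0 \<or> a + inverse w \<notin> \<Gamma>}"
  have a: "a \<in> \<Gamma>" unfolding a_def \<Gamma>_def by (rule pathstart_in_path_image)
  have cg: "compact \<Gamma>" using assms by (simp add: \<Gamma>_def compact_arc_image)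
  then have closed\<Gamma>: "closed \<Gamma>" by (rule compact_imp_closed)
  obtain B where B: "B > 0" "\<And>z. z \<in> \<Gamma> \<Longrightarrow> norm (z - a) \<le> B"
  proof -
    have "bounded ((\<lambda>z. z - a) ` \<Gamma>)"
      by (intro compact_imp_bounded compact_continuous_image continuous_intros cg)
    then show ?thesis using that unfolding bounded_pos by auto
  qed
  have inU: "inverse (z - a) \<in> U \<longleftrightarrow> z \<notin> \<Gamma>" if "z \<noteq> a" for z
    using that by (auto simp: U_def)
  have cU: "- U = (\<lambda>z. inverse (z - a)) ` (\<Gamma> - {a})"
  proof
    show "- U \<subseteq> (\<lambda>z. inverse (z - a)) ` (\<Gamma> - {a})"
    proof
      fix w assume "w \<in> - U"
      then have "w \<noteq> 0" "a + inverse w \<in> \<Gamma>" by (auto simp: U_def)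
      then show "w \<in> (\<lambda>z. inverse (z - a)) ` (\<Gamma> - {a})"
        by (intro image_eqI[of _ _ "a + inverse w"]) auto
    qed
  qed (auto simp: U_def)
  have U0: "U - {0} = (\<lambda>z. inverse (z - a)) ` (- \<Gamma>)"
  proof
    show "U - {0} \<subseteq> (\<lambda>z. inverse (z - a)) ` (- \<Gamma>)"
    proof
      fix w assume "w \<in> U - {0}"
      then have "w \<noteq> 0" "a + inverse w \<notin> \<Gamma>" by (auto simp: U_def)
      then show "w \<in> (\<lambda>z. inverse (z - a)) ` (- \<Gamma>)"
        by (intro image_eqI[of _ _ "a + inverse w"]) auto
    qed
  qed (use a in \<open>auto simp: U_def\<close>)
  have "open U"
  proof -
    \<comment> \<open>The arc stays within \<open>B\<close> of \<open>a\<close>, so its image stays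
      at distance at least \<open>1/B\<close> from \<open>0\<close>, where inversion is
      continuous.\<close>
    have *: "- U = {w. norm w \<ge> 1/B} \<inter> (\<lambda>w. a + inverse w) -` \<Gamma>"
    proof
      show "- U \<subseteq> {w. norm w \<ge> 1/B} \<inter> (\<lambda>w. a + inverse w) -` \<Gamma>"
      proof
        fix w assume "w \<in> - U"
        then have w: "w \<noteq> 0" "a + inverse w \<in> \<Gamma>" by (auto simp: U_def)
        from B(2)[OF w(2)] have "inverse (norm w) \<le> B" by (simp add: norm_inverse)
        then show "w \<in> {w. norm w \<ge> 1/B} \<inter> (\<lambda>w. a + inverse w) -` \<Gamma>"
          using w B(1) by (simp add: field_simps)
      qed
      show "{w. norm w \<ge> 1/B} \<inter> (\<lambda>w. a + inverse w) -` \<Gamma> \<subseteq> - U"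
        using B(1) by (auto simp: U_def)
    qed
    have "continuous_on {w. norm w \<ge> 1/B} (\<lambda>w::complex. a + inverse w)"
      using B(1) by (intro continuous_intros) auto
    moreover have "closed {w::complex. norm w \<ge> 1/B}"
      by (intro closed_Collect_le continuous_intros)
    ultimately have "closed (- U)"
      unfolding * by (intro continuous_closed_preimage closed\<Gamma>)
    then show ?thesis by (simp add: closed_def)
  qed
  have conn: "connected (\<Gamma> - {a})"
    unfolding \<Gamma>_def a_def using assms by (rule connected_arc_minus_start)
  have "connected (- U)"
    unfolding cU by (intro connected_continuous_image conn continuous_intros) auto
  \<comment> \<open>An open connected set of the plane is simply connected if all components of its
    complement are unbounded. Here the complement is connected, and unbounded because
    \<open>a\<close> is a limit point of the arc.\<close>
  moreover have "\<not> bounded (- U)"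
  proof
    assume "bounded (- U)"
    then obtain C where C: "C > 0" "\<And>w. w \<in> - U \<Longrightarrow> norm w \<le> C" by (auto simp: bounded_pos)
    have "connected \<Gamma>" using assms by (simp add: \<Gamma>_def connected_arc_image)
    moreover have "pathfinish g \<in> \<Gamma>" "pathfinish g \<noteq> a"
      using assms arc_distinct_ends by (auto simp: \<Gamma>_def a_def)
    ultimately have "a islimpt \<Gamma>"
      using a connected_imp_perfect by blast
    then obtain z where z: "z \<in> \<Gamma>" "z \<noteq> a" "dist z a < 1/C"
      using C(1) unfolding islimpt_approachable by (metis zero_less_divide_1_iff)
    have "norm (inverse (z - a)) \<le> C" using z by (intro C(2)) (auto simp: cU)
    then show False using z C(1) by (simp add: norm_inverse norm_divide dist_norm field_simps)
  qed
  moreover have "connected U"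
  proof (rule connected_intermediate_closure)
    show "connected (U - {0})"
      unfolding U0
    proof (intro connected_continuous_image continuous_intros)
      show "connected (- \<Gamma>)" using assms by (simp add: \<Gamma>_def connected_arc_complement)
    qed (use a in auto)
    show "U \<subseteq> closure (U - {0})"
    proof
      fix w assume "w \<in> U"
      then have "w islimpt U" using \<open>open U\<close> interior_limit_point interior_open by blast
      then show "w \<in> closure (U - {0})"
        by (metis UnI2 closure_def insert_Diff_single islimpt_insert mem_Collect_eq)
    qed
  qed auto
  moreover have "C = - U" if "C \<in> components (- U)" for C
    using that \<open>connected (- U)\<close> by (metis components_eq_sing_iff empty_iff singletonD components_empty)
  ultimately have "simply_connected U"
    using simply_connected_eq_unbounded_complement_components[OF \<open>open U\<close>] by metis
  moreover have "0 \<in> U" by (simp add: U_def)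
  ultimately have "U homeomorphic (UNIV :: complex set)"
    using simply_connected_eq_homeomorphic_to_disc[OF \<open>open U\<close>] homeomorphic_ball01_UNIV
      homeomorphic_trans by blast
  then obtain h0 k0 :: "complex \<Rightarrow> complex" where "homeomorphism U UNIV h0 k0" by (auto simp: homeomorphic_def)
  \<comment> \<open>The translation makes \<open>h\<close> fix \<open>0\<close>, that is, infinity.
    Off the arc \<open>h (inverse (z - a))\<close> is then nonzero and can be inverted back.\<close>
  define h where "h = (\<lambda>w. h0 w - h0 0)"
  define k where "k = (\<lambda>w. k0 (w + h0 0))"
  have kh: "k (h w) = w" if "w \<in> U" for w
    using \<open>homeomorphism U UNIV h0 k0\<close> that by (simp add: h_def k_def homeomorphism_def)
  have hk: "h (k w) = w" for w
    using \<open>homeomorphism U UNIV h0 k0\<close> by (simp add: h_def k_def homeomorphism_def)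
  have kU: "k w \<in> U" for w
    using \<open>homeomorphism U UNIV h0 k0\<close> by (auto simp: k_def homeomorphism_def)
  have conth: "continuous_on U h"
    using \<open>homeomorphism U UNIV h0 k0\<close> by (auto simp: h_def homeomorphism_def intro!: continuous_intros)
  have contk: "continuous_on UNIV k"
  proof -
    have "continuous_on UNIV k0"
      using \<open>homeomorphism U UNIV h0 k0\<close> by (simp add: homeomorphism_def)
    moreover have "continuous_on UNIV (\<lambda>w. w + h0 0)"
      by (intro continuous_on_add continuous_on_id continuous_on_const)
    ultimately show ?thesis
      unfolding k_def by (rule continuous_on_compose2) simp
  qed
  have h0: "h 0 = 0" by (simp add: h_def)
  have hne: "h (inverse (z - a)) \<noteq> 0" if "z \<notin> \<Gamma>" for z
  proof
    assume "h (inverse (z - a)) = 0"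
    then have "inverse (z - a) = 0"
      using that a kh[of "inverse (z - a)"] kh[of 0] h0 \<open>0 \<in> U\<close> inU[of z] by force
    then show False using that a by auto
  qed
  \<comment> \<open>When \<open>z\<close> approaches the arc, \<open>h (inverse (z - a))\<close>
    leaves every bounded set, so its inverse tends to \<open>0\<close>; this dictates the value on
    the arc.\<close>
  define q where "q = (\<lambda>z. if z \<in> \<Gamma> then 0 else inverse (h (inverse (z - a))))"
  have q0: "q z = 0 \<longleftrightarrow> z \<in> \<Gamma>" for z using hne[of z] by (auto simp: q_def)
  have "isCont q z" if z: "z \<notin> \<Gamma>" for z
  proof -
    have "continuous_on (- \<Gamma>) (\<lambda>z. inverse (h (inverse (z - a))))"
    proof (intro continuous_on_inverse continuous_on_compose2[OF conth] continuous_intros)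
      show "(\<lambda>z. inverse (z - a)) ` (- \<Gamma>) \<subseteq> U" using inU a by fastforce
    qed (use hne a in auto)
    then have "continuous_on (- \<Gamma>) q" 
      by (rule continuous_on_eq) (auto simp: q_def)
    then show ?thesis
      using z cg compact_imp_closed continuous_on_eq_continuous_at open_Compl by blast
  qed
  moreover have "isCont q z" if z: "z \<in> \<Gamma>" for z
    unfolding continuous_at_eps_delta dist_norm
  proof (intro allI impI)
    fix e :: real assume e: "e > 0"
    define K where "K = k ` cball 0 (1/e)"
    have K: "compact K" unfolding K_def
      using contk by (intro compact_continuous_image) (auto elim: continuous_on_subset)
    obtain C where C: "C > 0" "\<And>w. w \<in> K \<Longrightarrow> norm w \<le> C"
      using compact_imp_bounded[OF K] by (auto simp: bounded_pos)
    \<comment> \<open>\<open>P\<close> contains all points with \<open>norm (q x) \<ge> e\<close>,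
      and it misses the arc because \<open>K\<close> lies in \<open>U\<close>. The bound
      \<open>1/C\<close> holds for every point with coordinate in \<open>K\<close>; it keeps
      \<open>P\<close> away from the pole \<open>a\<close>, so that \<open>P\<close> is
      closed.\<close>
    define P where "P = {z. norm (z - a) \<ge> 1/C} \<inter> (\<lambda>z. inverse (z - a)) -` K"
    have "closed P" unfolding P_def
    proof (intro continuous_closed_preimage compact_imp_closed[OF K] continuous_intros)
      show "closed {z. norm (z - a) \<ge> 1/C}"
        by (intro closed_Collect_le continuous_intros)
    qed (use C(1) in auto)
    moreover have "z \<notin> P"
    proof
      assume "z \<in> P"
      then have "inverse (z - a) \<in> U" "z \<noteq> a" using kU C(1) by (auto simp: P_def K_def)
      then show False using z inU by blast
    qed
    ultimately obtain d where d: "d > 0" "ball z d \<subseteq> - P"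
      by (metis ComplI open_Compl open_contains_ball)
    show "\<exists>d>0. \<forall>x'. norm (x' - z) < d \<longrightarrow> norm (q x' - q z) < e"
    proof (intro exI[of _ d] conjI allI impI)
      show "d > 0" by (fact d(1))
      fix x assume "norm (x - z) < d"
      then have "x \<in> ball z d" by (simp add: dist_norm norm_minus_commute)
      then have xP: "x \<notin> P" using d(2) by blast
      have "norm (q x) < e"
      proof (rule ccontr)
        assume "\<not> norm (q x) < e"
        then have big: "norm (q x) \<ge> e" by simp
        then have xn: "x \<notin> \<Gamma>" using e q0 by force
        define w where "w = inverse (x - a)"
        have "x \<noteq> a" using xn a by blast
        then have w: "w \<in> U" "w \<noteq> 0" "x \<noteq> a" using xn inU[of x] by (auto simp: w_def)
        have "norm (inverse (h w)) \<ge> e" using big xn by (simp add: q_def w_def)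
        then have "norm (h w) \<le> 1/e" 
          using e hne[OF xn] by (simp add: norm_inverse norm_divide w_def field_simps)
        then have "w \<in> K" using kh[OF w(1)] unfolding K_def by (metis image_eqI mem_cball_0)
        moreover have "norm (x - a) \<ge> 1/C"
          using C(2)[OF \<open>w \<in> K\<close>] C(1) w by (simp add: w_def norm_inverse norm_divide field_simps)
        ultimately show False using xP by (simp add: P_def w_def)
      qed
      then show "norm (q x - q z) < e" using z by (simp add: q_def)
    qed
  qed
  ultimately have "continuous_on UNIV q"
    by (metis continuous_at_imp_continuous_on)
  moreover have "q z = q w \<longleftrightarrow> z = w \<or> z \<in> path_image g \<and> w \<in> path_image g" for z w
  proof (cases "z \<in> \<Gamma> \<or> w \<in> \<Gamma>")
    case True
    then show ?thesis using q0 unfolding \<Gamma>_def[symmetric] by metis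
  next
    case False
    then have "z \<noteq> a" "w \<noteq> a" using a by auto
    have "z = w" if "q z = q w"
    proof -
      have "h (inverse (z - a)) = h (inverse (w - a))" using that False by (simp add: q_def)
      then have "inverse (z - a) = inverse (w - a)"
        using kh inU False \<open>z \<noteq> a\<close> \<open>w \<noteq> a\<close> by metis
      then show ?thesis by simp
    qed
    then show ?thesis using False by (auto simp: \<Gamma>_def)
  qed
  ultimately show ?thesis using that by blast
qed

text \<open>Induction on the set of arcs: the next arc is pushed through the map that collapses the
  earlier ones. It misses all of them, so the map is injective on it, and its image is again an arc
  to which the single collapse applies.\<close>

lemma disjoint_arcs_collapse:
  fixes g :: "'i \<Rightarrow> real \<Rightarrow> complex"
  assumes "finite I" and "\<And>i. i \<in> I \<Longrightarrow> arc (g i)"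
    and "\<And>i j. i \<in> I \<Longrightarrow> j \<in> I \<Longrightarrow> i \<noteq> j \<Longrightarrow> path_image (g i) \<inter> path_image (g j) = {}"
  shows "\<exists>q :: complex \<Rightarrow> complex. continuous_on UNIV q \<and>
    (\<forall>z w. q z = q w \<longleftrightarrow> z = w \<or> (\<exists>i\<in>I. z \<in> path_image (g i) \<and> w \<in> path_image (g i)))"
  using assms
proof (induction I)
  case empty
  then show ?case by (intro exI[of _ id]) (auto simp: continuous_on_id)
next
  case (insert j I)
  have "\<exists>q :: complex \<Rightarrow> complex. continuous_on UNIV q \<and>
    (\<forall>z w. q z = q w \<longleftrightarrow> z = w \<or> (\<exists>i\<in>I. z \<in> path_image (g i) \<and> w \<in> path_image (g i)))"
    by (rule insert.IH) (use insert.prems in auto)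
  then obtain q :: "complex \<Rightarrow> complex" where q: "continuous_on UNIV q"
    "\<And>z w. q z = q w \<longleftrightarrow> z = w \<or> (\<exists>i\<in>I. z \<in> path_image (g i) \<and> w \<in> path_image (g i))"
    by blast
  have dis: "z \<notin> path_image (g i)" if "z \<in> path_image (g j)" "i \<in> I" for z i
    using insert.prems(2)[of j i] insert.hyps(2) that by auto
  have "arc (q \<circ> g j)"
  proof -
    have "arc (g j)" using insert.prems(1) by simp
    moreover have "inj_on q (path_image (g j))" using dis q(2) by (auto simp: inj_on_def)
    moreover have "continuous_on (path_image (g j)) q" using q(1) continuous_on_subset by blast
    ultimately show ?thesis by (metis arc_def comp_inj_on path_continuous_image path_image_def)
  qed
  then obtain q' :: "complex \<Rightarrow> complex" where q': "continuous_on UNIV q'"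
    "\<And>z w. q' z = q' w \<longleftrightarrow> z = w \<or> z \<in> path_image (q \<circ> g j) \<and> w \<in> path_image (q \<circ> g j)"
    using arc_collapse[of "q \<circ> g j"] by metis
  have mem: "q z \<in> path_image (q \<circ> g j) \<longleftrightarrow> z \<in> path_image (g j)" for z
    using q(2) dis unfolding path_image_compose by (metis imageE imageI)
  show ?case
  proof (intro exI[of _ "q' \<circ> q"] conjI allI)
    show "continuous_on UNIV (q' \<circ> q)"
      using q(1) q'(1) continuous_on_compose continuous_on_subset by blast
    show "(q' \<circ> q) z = (q' \<circ> q) w \<longleftrightarrow>
      z = w \<or> (\<exists>i\<in>insert j I. z \<in> path_image (g i) \<and> w \<in> path_image (g i))" for z w
      using q'(2)[of "q z" "q w"] q(2)[of z w] by (auto simp only: o_apply mem bex_simps)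
  qed
qed

section \<open>Orientation and sectors of a disc\<close>

text \<open>Twice the signed area of the triangle \<open>p\<close>, \<open>q\<close>,
  \<open>z\<close>; positive when \<open>z\<close> lies to the left of the line directed from
  \<open>p\<close> to \<open>q\<close>.\<close>

definition orient :: "complex \<Rightarrow> complex \<Rightarrow> complex \<Rightarrow> real" where
  "orient p q z = Im (cnj (q - p) * (z - p))"

lemma orient_swap: "orient p z q = - orient p q z"
  by (simp add: orient_def algebra_simps)

lemma orient_rotate: "orient q z p = orient p q z"
  by (simp add: orient_def algebra_simps)

lemma orient_affine:
  assumes "s + t = 1"
  shows "orient p q (s *\<^sub>R x + t *\<^sub>R y) = s * orient p q x + t * orient p q y"
proof -
  have s: "s = 1 - t" using assms by simp
  show ?thesis unfolding s by (simp add: orient_def algebra_simps)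
qed

text \<open>The area of a triangle is the sum of the signed areas spanned by its sides with an apex
  \<open>a\<close>. This translates the side of the chord \<open>pq\<close> on which a point lies
  into data at the centre of the circle.\<close>

lemma orient_change: "orient p q z = orient a p q - orient a p z + orient a q z"
  by (simp add: orient_def algebra_simps)

lemma orient_same [simp]: "orient p p z = 0" "orient p q p = 0" "orient p q q = 0"
  by (simp_all add: orient_def algebra_simps)

lemma orient_segment: "z \<in> closed_segment p q \<Longrightarrow> orient p q z = 0"
  by (auto simp: in_segment orient_affine)

lemma orient_eq_0_imp_collinear:
  assumes "orient p q z = 0" "p \<noteq> q"
  obtains t where "z - p = t *\<^sub>R (q - p)"
proof -
  have "Re (q - p) * Im (z - p) = Im (q - p) * Re (z - p)"
    using assms(1) by (simp add: orient_def algebra_simps)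
  then have "z - p = ((z - p) \<bullet> (q - p) / (norm (q - p))\<^sup>2) *\<^sub>R (q - p)"
  proof -
    define u v where "u = q - p" and "v = z - p"
    have e: "Re u * Im v = Im u * Re v"
      using \<open>Re (q - p) * Im (z - p) = Im (q - p) * Re (z - p)\<close> by (simp add: u_def v_def)
    have n: "(norm u)\<^sup>2 \<noteq> 0" using assms(2) by (simp add: u_def)
    have "(norm u)\<^sup>2 *\<^sub>R v = (v \<bullet> u) *\<^sub>R u"
    proof (rule complex_eqI)
      show "Re ((norm u)\<^sup>2 *\<^sub>R v) = Re ((v \<bullet> u) *\<^sub>R u)"
        "Im ((norm u)\<^sup>2 *\<^sub>R v) = Im ((v \<bullet> u) *\<^sub>R u)"
        unfolding cmod_power2 inner_complex_def scaleR_complex.sel using e by algebra+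
    qed
    then have "v = ((v \<bullet> u) / (norm u)\<^sup>2) *\<^sub>R u"
      using n by (metis divideR_right scaleR_scaleR divide_inverse_commute)
    then show ?thesis by (simp add: u_def v_def)
  qed
  then show ?thesis using that by blast
qed

text \<open>A line meets a circle at most twice: at \<open>p + t (q - p)\<close>, being at distance
  \<open>r\<close> from the centre is a quadratic equation in \<open>t\<close> with the roots 0 and
  1.\<close>

lemma orient_circle_nonzero:
  assumes "dist a p = r" "dist a q = r" "dist a z = r" "p \<noteq> q" "p \<noteq> z" "q \<noteq> z"
  shows "orient p q z \<noteq> 0"
proof
  assume "orient p q z = 0"
  then obtain t where t: "z - p = t *\<^sub>R (q - p)"
    using assms(4) orient_eq_0_imp_collinear by blast
  define u d where "u = p - a" and "d = q - p"
  have "q - a = u + d" "z - a = u + t *\<^sub>R d"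
    using t by (auto simp: u_def d_def algebra_simps)
  then have "norm u = r" "norm (u + d) = r" "norm (u + t *\<^sub>R d) = r"
    using assms(1-3) by (metis u_def dist_commute dist_norm)+
  then have "(norm u)\<^sup>2 = r\<^sup>2" "(norm (u + d))\<^sup>2 = r\<^sup>2" "(norm (u + t *\<^sub>R d))\<^sup>2 = r\<^sup>2" by auto
  then have "u \<bullet> u = r\<^sup>2" "u \<bullet> u + 2 * (u \<bullet> d) + d \<bullet> d = r\<^sup>2"
    "u \<bullet> u + 2 * t * (u \<bullet> d) + t * t * (d \<bullet> d) = r\<^sup>2"
    by (auto simp: power2_norm_eq_inner inner_simps inner_commute)
  then have "t * (t - 1) * (d \<bullet> d) = 0" by algebra
  moreover have "d \<bullet> d \<noteq> 0" using assms(4) by (simp add: d_def)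
  ultimately have "t = 0 \<or> t = 1" by auto
  then show False using t assms(5,6) by auto
qed

text \<open>\<open>orient p q\<close> is affine and vanishes at the common point, so nonzero values
  at the ends of the other segment must differ in sign.\<close>

lemma crossing_segments_orient:
  assumes "closed_segment p q \<inter> closed_segment x y \<noteq> {}" "orient p q x \<noteq> 0" "orient p q y \<noteq> 0"
  shows "orient p q x * orient p q y < 0"
proof -
  obtain z where z: "z \<in> closed_segment p q" "z \<in> closed_segment x y" using assms(1) by auto
  then obtain t where t: "0 \<le> t" "t \<le> 1" "z = (1 - t) *\<^sub>R x + t *\<^sub>R y" by (auto simp: in_segment)
  have 0: "(1 - t) * orient p q x + t * orient p q y = 0"
    using orient_segment[OF z(1)] t(3) orient_affine[of "1 - t" t p q x y] by simp
  show ?thesis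
  proof (rule ccontr)
    assume "\<not> ?thesis"
    then consider "orient p q x > 0" "orient p q y > 0" | "orient p q x < 0" "orient p q y < 0"
      using assms(2,3) by (metis linorder_neqE_linordered_idom mult_neg_pos mult_pos_neg)
    then show False
    proof cases
      case 1
      then have "(1 - t) * orient p q x \<ge> 0" "t * orient p q y \<ge> 0" using t by simp_all
      then have "(1 - t) * orient p q x = 0" "t * orient p q y = 0" using 0 by linarith+
      then show False using 1 by auto
    next
      case 2
      then have "(1 - t) * orient p q x \<le> 0" "t * orient p q y \<le> 0"
        using t by (simp_all add: mult_nonneg_nonpos)
      then have "(1 - t) * orient p q x = 0" "t * orient p q y = 0" using 0 by linarith+
      then show False using 2 by auto
    qed
  qed
qed

lemma segments_common_end:
  assumes "z \<in> closed_segment x p" "z \<in> closed_segment x q" "orient x p q \<noteq> 0"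
  shows "z = x"
proof -
  obtain t where t: "z = (1 - t) *\<^sub>R x + t *\<^sub>R q" using assms(2) by (auto simp: in_segment)
  have "t * orient x p q = 0"
    using orient_segment[OF assms(1)] t orient_affine[of "1 - t" t x p x q] by simp
  then show ?thesis using t assms(3) by simp
qed

lemma orient_reverse: "orient q p z = - orient p q z"
  by (simp add: orient_def algebra_simps)

lemma convex_orient_pos: "convex {z. orient p q z > 0}"
proof (rule convexI)
  fix x y and u v :: real
  assume *: "x \<in> {z. orient p q z > 0}" "y \<in> {z. orient p q z > 0}" "0 \<le> u" "0 \<le> v" "u + v = 1"
  have "u * orient p q x + v * orient p q y > 0"
  proof (cases "u = 0")
    case False
    then have "u * orient p q x > 0" "v * orient p q y \<ge> 0" using * by simp_all
    then show ?thesis by linarith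
  qed (use * in simp)
  then show "u *\<^sub>R x + v *\<^sub>R y \<in> {z. orient p q z > 0}"
    using * by (simp add: orient_affine)
qed

lemma convex_orient_neg: "convex {z. orient p q z < 0}"
  using convex_orient_pos[of q p] by (simp add: orient_reverse[of q p])

lemmas convex_orient = convex_orient_pos convex_orient_neg

text \<open>The two open sectors cut out of a disc by the radii to \<open>p\<close> and \<open>q\<close>; a point of the circle
  lies in the sector that the line through \<open>p\<close> and \<open>q\<close> assigns to it.\<close>

definition sectors :: "complex \<Rightarrow> complex \<Rightarrow> complex \<Rightarrow> real \<Rightarrow> complex set \<Rightarrow> complex set \<Rightarrow> bool" where
  "sectors a p q r A B \<longleftrightarrow> connected A \<and> connected B \<and> A \<union> B \<subseteq> cball a r \<and>
    (A \<union> B) \<inter> (closed_segment a p \<union> closed_segment a q) = {} \<and>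
    cball a r \<subseteq> A \<union> B \<union> closed_segment a p \<union> closed_segment a q \<and>
    (\<forall>z. dist a z = r \<longrightarrow> orient p q z < 0 \<longrightarrow> closed_segment a z - {a} \<subseteq> A) \<and>
    (\<forall>z. dist a z = r \<longrightarrow> orient p q z > 0 \<longrightarrow> closed_segment a z - {a} \<subseteq> B)"

lemma orient_ray:
  assumes "z \<in> closed_segment a w" "z \<noteq> a"
  obtains t where "t > 0" "t \<le> 1" "\<And>p. orient a p z = t * orient a p w"
proof -
  obtain t where t: "0 \<le> t" "t \<le> 1" "z = (1 - t) *\<^sub>R a + t *\<^sub>R w"
    using assms(1) by (auto simp: in_segment)
  have "t \<noteq> 0" using t(3) assms(2) by auto
  then show ?thesis
    using t that[of t] orient_affine[of "1 - t" t a _ a w] by simp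
qed

lemma on_radius:
  fixes a p z :: "'a :: real_normed_vector"
  assumes "dist a p = r" "r > 0" "dist a z \<le> r" "z - a = t *\<^sub>R (p - a)" "t \<ge> 0"
  shows "z \<in> closed_segment a p"
proof -
  have "norm (p - a) = r" "norm (z - a) \<le> r"
    using assms(1,3) by (simp_all add: dist_norm norm_minus_commute)
  then have "t * r \<le> r" using assms(4,5) by simp
  then have "t \<le> 1" using assms(2) by simp
  moreover have "z = (1 - t) *\<^sub>R a + t *\<^sub>R p" using assms(4) by (simp add: algebra_simps)
  ultimately show ?thesis using assms(5) unfolding in_segment by blast
qed

text \<open>The case of an angle below a half turn: one sector is convex, the intersection of the
  disc with two half-planes; the other is a union of two overlapping open half-discs.\<close>

lemma sectors_pos:
  assumes r: "r > 0" and p: "dist a p = r" and q: "dist a q = r" and d: "orient a p q > 0"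
  shows "sectors a p q r (cball a r \<inter> {z. orient a p z > 0 \<and> orient a q z < 0})
    (cball a r \<inter> {z. orient a p z < 0 \<or> orient a q z > 0})"
proof -
  define d where "d = orient a p q"
  have d0: "d > 0" using d by (simp add: d_def)
  have qp: "orient a q p = - d" by (simp add: d_def orient_swap[of a p q])
  \<comment> \<open>Cramer's rule in the basis \<open>p - a\<close>, \<open>q - a\<close>. By
    \<open>orient_change\<close> a point lies beyond the chord \<open>pq\<close>, seen from
    \<open>a\<close>, iff the two coefficients add up to more than 1.\<close>
  have basis: "z - a = (- orient a q z / d) *\<^sub>R (p - a) + (orient a p z / d) *\<^sub>R (q - a)" for z
  proof -
    have "d *\<^sub>R (z - a) = (- orient a q z) *\<^sub>R (p - a) + orient a p z *\<^sub>R (q - a)"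
      unfolding d_def by (simp add: orient_def complex_eq_iff algebra_simps)
    then have "(1/d) *\<^sub>R (d *\<^sub>R (z - a)) = (1/d) *\<^sub>R ((- orient a q z) *\<^sub>R (p - a) + orient a p z *\<^sub>R (q - a))"
      by simp
    moreover have "(1/d) *\<^sub>R ((- y) *\<^sub>R u + x *\<^sub>R v) = (- y / d) *\<^sub>R u + (x / d) *\<^sub>R v" for x y and u v :: complex
      by (simp add: scaleR_right_diff_distrib)
    ultimately show ?thesis using d0 by (simp only: scaleR_scaleR) simp
  qed
  let ?A = "{z. orient a p z > 0 \<and> orient a q z < 0}"
  let ?B = "{z. orient a p z < 0 \<or> orient a q z > 0}"
  have norms: "norm (p - a) = r" "norm (q - a) = r" using p q by (auto simp: dist_norm norm_minus_commute)
  have "cball a r \<inter> ?A = cball a r \<inter> {z. orient a p z > 0} \<inter> {z. orient a q z < 0}" by auto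
  then have A: "connected (cball a r \<inter> ?A)" by (simp add: convex_connected convex_Int convex_orient)
  have "cball a r \<inter> ?B = cball a r \<inter> {z. orient a p z < 0} \<union> cball a r \<inter> {z. orient a q z > 0}" by auto
  moreover have "connected (cball a r \<inter> {z. orient a p z < 0} \<union> cball a r \<inter> {z. orient a q z > 0})"
  proof (intro connected_Un convex_connected convex_Int convex_cball convex_orient)
    \<comment> \<open>The midpoint of the chord reflected in the centre: it lies in both
      half-discs.\<close>
    define z where "z = a - (1/2) *\<^sub>R ((p - a) + (q - a))"
    have "orient a p z = - d / 2" "orient a q z = d / 2"
      by (simp_all add: z_def d_def orient_def algebra_simps) 
    moreover have "norm (a - z) \<le> r"
      using norm_triangle_ineq[of "p - a" "q - a"] norms by (simp add: z_def)
    ultimately have "z \<in> (cball a r \<inter> {z. orient a p z < 0}) \<inter> (cball a r \<inter> {z. orient a q z > 0})"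
      using d0 by (simp add: dist_norm)
    then show "(cball a r \<inter> {z. orient a p z < 0}) \<inter> (cball a r \<inter> {z. orient a q z > 0}) \<noteq> {}" by blast
  qed
  ultimately have B: "connected (cball a r \<inter> ?B)" by simp
  have dis: "(?A \<union> ?B) \<inter> (closed_segment a p \<union> closed_segment a q) = {}"
  proof -
    have "z \<notin> ?A \<union> ?B" if z: "z \<in> closed_segment a w" and w: "w = p \<or> w = q" for z w
    proof (cases "z = a")
      case False
      then obtain t where t: "t > 0" "\<And>p. orient a p z = t * orient a p w"
        using orient_ray[OF z] by metis
      have "orient a p q > 0" "orient a q p < 0" using d0 qp by (simp_all add: d_def)
      then show ?thesis using w t by (auto simp: zero_less_mult_iff mult_less_0_iff)
    qed simp
    then show ?thesis by blast
  qed
  have cov: "cball a r \<subseteq> ?A \<union> ?B \<union> closed_segment a p \<union> closed_segment a q"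
  proof
    fix z assume z: "z \<in> cball a r"
    show "z \<in> ?A \<union> ?B \<union> closed_segment a p \<union> closed_segment a q"
    proof (cases "z \<in> ?A \<union> ?B")
      case False
      then consider "orient a p z = 0" "orient a q z \<le> 0" | "orient a p z \<ge> 0" "orient a q z = 0"
        by fastforce
      then show ?thesis
      proof cases
        case 1
        then have "z \<in> closed_segment a p"
          using basis[of z] d0 z p r by (intro on_radius[of a p r z "- orient a q z / d"]) (auto simp: divide_nonpos_pos)
        then show ?thesis by blast
      next
        case 2
        then have "z \<in> closed_segment a q"
          using basis[of z] d0 z q r by (intro on_radius[of a q r z "orient a p z / d"]) auto
        then show ?thesis by blast
      qed
    qed auto
  qed
  have zA: "z \<in> ?A" if z: "dist a z = r" "orient p q z < 0" for z
  proof -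
    define \<alpha> \<beta> where "\<alpha> = - orient a q z / d" and "\<beta> = orient a p z / d"
    have zz: "z - a = \<alpha> *\<^sub>R (p - a) + \<beta> *\<^sub>R (q - a)" using basis[of z] by (simp add: \<alpha>_def \<beta>_def)
    have s: "\<alpha> + \<beta> > 1" using z(2) orient_change[of p q z a] d0
      by (simp add: \<alpha>_def \<beta>_def d_def field_simps)
    have nz: "norm (z - a) = r" using z by (simp add: dist_norm norm_minus_commute)
    \<comment> \<open>All three vectors have length \<open>r\<close>, so neither coefficient exceeds
      the other in absolute value by more than 1. With a sum above 1 this leaves only positive
      coefficients.\<close>
    have "\<bar>\<alpha>\<bar> * r \<le> r + \<bar>\<beta>\<bar> * r"
      using norm_triangle_ineq4[of "z - a" "\<beta> *\<^sub>R (q - a)"] nz norms by (simp add: zz)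
    then have "\<bar>\<alpha>\<bar> * r \<le> (1 + \<bar>\<beta>\<bar>) * r" by (simp add: distrib_right)
    then have 1: "\<bar>\<alpha>\<bar> \<le> 1 + \<bar>\<beta>\<bar>" using r by (simp only: mult_le_cancel_right_pos)
    have "\<bar>\<beta>\<bar> * r \<le> r + \<bar>\<alpha>\<bar> * r"
      using norm_triangle_ineq4[of "z - a" "\<alpha> *\<^sub>R (p - a)"] nz norms by (simp add: zz)
    then have "\<bar>\<beta>\<bar> * r \<le> (1 + \<bar>\<alpha>\<bar>) * r" by (simp add: distrib_right)
    then have 2: "\<bar>\<beta>\<bar> \<le> 1 + \<bar>\<alpha>\<bar>" using r by (simp only: mult_le_cancel_right_pos)
    have "\<alpha> > 0" "\<beta> > 0" using 1 2 s by linarith+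
    then show ?thesis using d0 by (simp add: \<alpha>_def \<beta>_def zero_less_divide_iff divide_less_0_iff)
  qed
  have zB: "z \<in> ?B" if z: "dist a z = r" "orient p q z > 0" for z
  proof (rule ccontr)
    assume nB: "z \<notin> ?B"
    define \<alpha> \<beta> where "\<alpha> = - orient a q z / d" and "\<beta> = orient a p z / d"
    have zz: "z - a = \<alpha> *\<^sub>R (p - a) + \<beta> *\<^sub>R (q - a)" using basis[of z] by (simp add: \<alpha>_def \<beta>_def)
    have s: "\<alpha> + \<beta> < 1" using z(2) orient_change[of p q z a] d0
      by (simp add: \<alpha>_def \<beta>_def d_def field_simps)
    \<comment> \<open>Nonnegative coefficients with sum below 1 would put \<open>z\<close> strictly
      inside the circle.\<close>
    have "\<alpha> \<ge> 0" "\<beta> \<ge> 0" using nB d0 by (auto simp: \<alpha>_def \<beta>_def divide_nonpos_pos)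
    then have "norm (z - a) \<le> \<alpha> * r + \<beta> * r"
      unfolding zz using norm_triangle_ineq[of "\<alpha> *\<^sub>R (p - a)" "\<beta> *\<^sub>R (q - a)"] norms by simp
    then have "1 * r \<le> (\<alpha> + \<beta>) * r" using z by (simp add: dist_norm norm_minus_commute algebra_simps)
    then show False using r s by simp
  qed
  have ray: "closed_segment a z - {a} \<subseteq> ?A" if "z \<in> ?A" for z
    using that by (auto elim!: orient_ray simp: zero_less_mult_iff mult_less_0_iff)
  have rayB: "closed_segment a z - {a} \<subseteq> ?B" if "z \<in> ?B" for z
    using that by (auto elim!: orient_ray simp: zero_less_mult_iff mult_less_0_iff)
  have seg: "closed_segment a z \<subseteq> cball a r" if "dist a z = r" for z
    using that r by (intro closed_segment_subset) auto
  have "closed_segment a z - {a} \<subseteq> cball a r \<inter> ?A" if "dist a z = r" "orient p q z < 0" for z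
    using ray[OF zA[OF that]] seg[OF that(1)] by blast
  moreover have "closed_segment a z - {a} \<subseteq> cball a r \<inter> ?B" if "dist a z = r" "orient p q z > 0" for z
    using rayB[OF zB[OF that]] seg[OF that(1)] by blast
  ultimately show ?thesis unfolding sectors_def
    using A B dis cov by (intro conjI) blast+
qed

text \<open>For antipodal \<open>p\<close> and \<open>q\<close> the chord passes through the centre.
  \<open>orient p q\<close> is then \<open>- 2\<close> times \<open>orient a p\<close>, which is why
  the half-disc with the positive sign comes first.\<close>

lemma sectors_opposite:
  assumes r: "r > 0" and p: "dist a p = r" and q: "q - a = - (p - a)"
  shows "sectors a p q r (cball a r \<inter> {z. orient a p z > 0}) (cball a r \<inter> {z. orient a p z < 0})"
proof -
  have oq: "orient a q z = - orient a p z" for z unfolding orient_def q by (simp add: algebra_simps)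
  have dis: "({z. orient a p z > 0} \<union> {z. orient a p z < 0}) \<inter> (closed_segment a p \<union> closed_segment a q) = {}"
    using orient_segment[of _ a p] orient_segment[of _ a q] oq by fastforce
  have pa: "p \<noteq> a" using p r by auto
  have dq: "dist a q = r" using p q by (metis dist_commute dist_norm norm_minus_cancel)
  have cov: "z \<in> closed_segment a p \<union> closed_segment a q" if z: "z \<in> cball a r" "orient a p z = 0" for z
  proof -
    obtain t where t: "z - a = t *\<^sub>R (p - a)" using orient_eq_0_imp_collinear z(2) pa by metis
    show ?thesis
    proof (cases "t \<ge> 0")
      case True
      then show ?thesis using on_radius[OF p r _ t] z(1) by auto
    next
      case False
      have "z - a = (-t) *\<^sub>R (q - a)" unfolding t q by (simp only: scaleR_minus_left scaleR_minus_right minus_minus)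
      then show ?thesis using on_radius[OF dq r] z(1) False by (metis UnI2 mem_cball neg_0_le_iff_le nle_le)
    qed
  qed
  have o: "orient p q z = - 2 * orient a p z" for z
    using orient_change[of p q z a] oq[of z] oq[of p] by (simp add: orient_swap[of a p q])
  have ray: "closed_segment a z - {a} \<subseteq> {z. orient a p z > 0}" if "orient a p z > 0" for z
    using that by (auto elim!: orient_ray)
  have ray': "closed_segment a z - {a} \<subseteq> {z. orient a p z < 0}" if "orient a p z < 0" for z
    using that by (auto elim!: orient_ray simp: mult_pos_neg)
  have seg: "closed_segment a z \<subseteq> cball a r" if "dist a z = r" for z
    using that r by (intro closed_segment_subset) auto
  have "closed_segment a z - {a} \<subseteq> cball a r \<inter> {z. orient a p z > 0}"
    if "dist a z = r" "orient p q z < 0" for z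
    using ray[of z] o[of z] seg that by auto
  moreover have "closed_segment a z - {a} \<subseteq> cball a r \<inter> {z. orient a p z < 0}"
    if "dist a z = r" "orient p q z > 0" for z
    using ray'[of z] o[of z] seg that by auto
  moreover have "z \<in> cball a r \<inter> {z. orient a p z > 0} \<union> cball a r \<inter> {z. orient a p z < 0}
      \<union> closed_segment a p \<union> closed_segment a q" if "z \<in> cball a r" for z
    using cov[OF that] that by (cases "orient a p z" "0 :: real" rule: linorder_cases) simp_all
  ultimately show ?thesis
    unfolding sectors_def using dis
    by (intro conjI convex_connected convex_Int convex_cball convex_orient subsetI) blast+
qed

lemma sectors_commute: "sectors a p q r A B \<Longrightarrow> sectors a q p r B A"
proof -
  assume *: "sectors a p q r A B"
  then show ?thesis unfolding sectors_def orient_reverse[of q p] by (simp add: Un_commute Un_left_commute Un_assoc)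
qed

lemma sectors_exist:
  assumes r: "r > 0" and p: "dist a p = r" and q: "dist a q = r" and "p \<noteq> q"
  obtains A B where "sectors a p q r A B"
proof (cases "orient a p q" "0 :: real" rule: linorder_cases)
  case less
  then have "orient a q p > 0" by (simp add: orient_swap[of a q p])
  then show ?thesis using sectors_pos[OF r q p] sectors_commute that by blast
next
  case greater
  then show ?thesis using sectors_pos[OF r p q] that by blast
next
  case equal
  have "p \<noteq> a" using p r by auto
  then obtain t where t: "q - a = t *\<^sub>R (p - a)"
    using equal orient_eq_0_imp_collinear by metis
  have "\<bar>t\<bar> * r = r" using p q t by (metis dist_commute dist_norm norm_scaleR)
  then have "t = 1 \<or> t = - 1" using r by auto
  then have "q - a = - (p - a)" using t \<open>p \<noteq> q\<close> by auto
  then show ?thesis using sectors_opposite[OF r p] that by blast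
qed

text \<open>Near \<open>a\<close> the curve consists of two radii only, so a connection from
  \<open>x'\<close> to \<open>y'\<close> would put both sectors into one component of the
  complement. But \<open>a\<close> is on the frontier of the inside and of the outside, so both of
  these meet the disc, hence the sectors.\<close>

lemma Jordan_corner:
  fixes c :: "real \<Rightarrow> complex"
  assumes c: "simple_path c" "pathfinish c = pathstart c"
    and r: "r > 0" and p: "dist a p = r" and q: "dist a q = r" and "p \<noteq> q"
    and S: "path_image c \<inter> cball a r = closed_segment a p \<union> closed_segment a q"
    and x: "dist a x = r" "orient p q x < 0" "x' \<in> closed_segment a x" "x' \<noteq> a"
    and y: "dist a y = r" "orient p q y > 0" "y' \<in> closed_segment a y" "y' \<noteq> a"
  shows "\<not> connected_component (- path_image c) x' y'"
proof
  assume xy: "connected_component (- path_image c) x' y'"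
  let ?S = "path_image c"
  obtain A B where AB: "sectors a p q r A B" using sectors_exist[OF r p q \<open>p \<noteq> q\<close>] .
  have ab: "connected A" "connected B" "(A \<union> B) \<inter> (closed_segment a p \<union> closed_segment a q) = {}"
    "cball a r \<subseteq> A \<union> B \<union> closed_segment a p \<union> closed_segment a q" "x' \<in> A" "y' \<in> B"
    using AB x y unfolding sectors_def by auto
  have sub: "A \<union> B \<subseteq> cball a r" using AB unfolding sectors_def by blast
  have "w \<notin> ?S" if "w \<in> A \<union> B" for w
  proof
    assume "w \<in> ?S"
    then have "w \<in> ?S \<inter> cball a r" using sub that by blast
    then have "w \<in> closed_segment a p \<union> closed_segment a q" by (simp only: S)
    then show False using ab(3) that by blast
  qed
  then have AS: "A \<subseteq> - ?S" "B \<subseteq> - ?S" by blast+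
  have conn: "connected_component (- ?S) x' w" if "w \<in> A \<union> B" for w
  proof -
    have "connected_component (- ?S) x' w" if "w \<in> A"
      using that AS(1) ab(1,5) connected_component_def by blast
    moreover have "connected_component (- ?S) x' w" if "w \<in> B"
      using that AS(2) ab(2,6) xy connected_component_trans connected_component_def by metis
    ultimately show ?thesis using that by blast
  qed
  have J: "open (inside ?S)" "inside ?S \<inter> outside ?S = {}" "frontier (inside ?S) = ?S"
    "frontier (outside ?S) = ?S"
    using Jordan_inside_outside[OF c] by auto
  have "a \<in> ?S" using S r by (metis IntD1 UnI1 ends_in_segment(1))
  have meet: "\<exists>w. w \<in> W \<and> w \<in> A \<union> B" if "frontier W = ?S" "W \<inter> ?S = {}" for W
  proof -
    have "a \<in> closure W" using \<open>a \<in> ?S\<close> that(1) by (metis Diff_iff frontier_def)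
    then obtain w where w: "w \<in> W" "dist w a < r" using r by (auto simp: closure_approachable)
    then have "w \<in> cball a r" by (simp add: dist_commute)
    then show ?thesis using w(1) that(2) S ab(4) by blast
  qed
  obtain u where u: "u \<in> inside ?S" "u \<in> A \<union> B"
    using meet[OF J(3)] by auto
  obtain v where v: "v \<in> outside ?S" "v \<in> A \<union> B"
    using meet[OF J(4)] by auto
  have "connected_component (- ?S) u v"
    using conn[OF u(2)] conn[OF v(2)] connected_component_sym connected_component_trans by metis
  then have "v \<in> inside ?S" using u(1) inside_same_component by metis
  then show False using v(1) J(2) by blast
qed

section \<open>Drawings with straight ends\<close>

text \<open>The arc is cut at its last time in the disc around \<open>a\<close> and then at the
  first later time in the disc around \<open>b\<close>; by the intermediate value theorem both
  points lie on the circles. All returns to the discs before and after are cut off with the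
  ends.\<close>

lemma arc_between_balls:
  fixes g :: "real \<Rightarrow> complex"
  assumes g: "arc g" "pathstart g = a" "pathfinish g = b" and r: "r > 0"
    and disj: "cball a r \<inter> cball b r = {}"
  obtains h where "arc h" "path_image h \<subseteq> path_image g"
    "dist a (pathstart h) = r" "dist b (pathfinish h) = r"
    "path_image h \<inter> cball a r = {pathstart h}" "path_image h \<inter> cball b r = {pathfinish h}"
proof -
  have contg: "continuous_on {0..1} g" using g(1) by (simp add: arc_def path_def)
  have g01: "g 0 = a" "g 1 = b" using g(2,3) by (auto simp: pathstart_def pathfinish_def)
  have far: "dist b z > r" if "dist a z \<le> r" for z using disj that by force
  define T1 where "T1 = {t \<in> {0..1}. dist a (g t) \<le> r}"
  have contd: "continuous_on {0..1} (\<lambda>t. dist c (g t))" for c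
    by (intro continuous_on_dist continuous_on_const contg)
  have clo: "compact {t \<in> {s..1}. dist c (g t) \<le> r}" if "s \<ge> 0" for c s
  proof -
    have "continuous_on {s..1} (\<lambda>t. dist c (g t))"
      using contd by (rule continuous_on_subset) (use that in auto)
    then have "closed ({s..1} \<inter> (\<lambda>t. dist c (g t)) -` {..r})"
      by (rule continuous_closed_preimage) auto
    moreover have "{s..1} \<inter> (\<lambda>t. dist c (g t)) -` {..r} = {t \<in> {s..1}. dist c (g t) \<le> r}" by auto
    ultimately have "closed {t \<in> {s..1}. dist c (g t) \<le> r}" by simp
    moreover have "bounded {t \<in> {s..1}. dist c (g t) \<le> r}"
      by (rule bounded_subset[of "{s..1}"]) auto
    ultimately show ?thesis by (simp add: compact_eq_bounded_closed)
  qed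
  have "0 \<in> T1" using g01 r by (simp add: T1_def)
  then obtain s where s: "s \<in> T1" "\<And>t. t \<in> T1 \<Longrightarrow> t \<le> s"
    using compact_attains_sup[of T1] clo[of 0 a] unfolding T1_def[symmetric] by auto
  have s01: "0 \<le> s" "s \<le> 1" "dist a (g s) \<le> r" using s(1) by (auto simp: T1_def)
  have a1: "dist a (g 1) > r" using far[of "g 1"] g01 r by force
  have ds: "dist a (g s) = r"
  proof -
    have "continuous_on {s..1} (\<lambda>t. dist a (g t))"
      using contd by (rule continuous_on_subset) (use s01 in auto)
    then obtain t where "s \<le> t" "t \<le> 1" "dist a (g t) = r"
      using IVT'[of "\<lambda>t. dist a (g t)" s r 1] s01 a1 by auto
    then show ?thesis using s(2)[of t] s01 by (auto simp: T1_def)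
  qed
  define T2 where "T2 = {t \<in> {s..1}. dist b (g t) \<le> r}"
  have "1 \<in> T2" using g01 r s01 by (simp add: T2_def)
  then obtain u where u: "u \<in> T2" "\<And>t. t \<in> T2 \<Longrightarrow> u \<le> t"
    using compact_attains_inf[of T2] clo[OF s01(1), of b] unfolding T2_def[symmetric] by auto
  have u01: "s \<le> u" "u \<le> 1" "dist b (g u) \<le> r" using u(1) by (auto simp: T2_def)
  have bs: "dist b (g s) > r" using far[of "g s"] s01 by simp
  then have "s < u" using u01 by (cases "s = u") auto
  have du: "dist b (g u) = r"
  proof -
    have "continuous_on {s..u} (\<lambda>t. dist b (g t))"
      using contd by (rule continuous_on_subset) (use s01 u01 in auto)
    then obtain t where "s \<le> t" "t \<le> u" "dist b (g t) = r"
      using IVT2'[of "\<lambda>t. dist b (g t)" u r s] u01 bs by auto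
    then show ?thesis using u(2)[of t] u01 by (auto simp: T2_def)
  qed
  define h where "h = subpath s u g"
  have im: "path_image h = g ` {s..u}" using u01 by (simp add: h_def path_image_subpath)
  have ph: "pathstart h = g s" "pathfinish h = g u" by (simp_all add: h_def)
  show ?thesis
  proof
    show "arc h" unfolding h_def using g(1) s01 u01 \<open>s < u\<close> by (intro arc_subpath_arc) auto
    show "path_image h \<subseteq> path_image g" using im s01 u01 by (auto simp: path_image_def)
    show "dist a (pathstart h) = r" "dist b (pathfinish h) = r" using ds du ph by auto
    have "t = s" if "s \<le> t" "t \<le> u" "dist a (g t) \<le> r" for t
      using s(2)[of t] that s01 u01 by (auto simp: T1_def)
    then show "path_image h \<inter> cball a r = {pathstart h}" unfolding im ph using ds u01 by force
    have "t = u" if "s \<le> t" "t \<le> u" "dist b (g t) \<le> r" for t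
      using u(2)[of t] that s01 u01 by (auto simp: T2_def)
    then show "path_image h \<inter> cball b r = {pathfinish h}" unfolding im ph using du u01 by force
  qed
qed

text \<open>The edge \<open>e\<close> runs along a radius from \<open>f u\<close> to the point \<open>p u e\<close> of the circle around \<open>f u\<close>, for each of its
  ends \<open>u\<close>, and along the middle arc \<open>M e\<close> in between.\<close>

locale disc_drawing =
  fixes V :: "'a set" and E :: "'a set set" and f :: "'a \<Rightarrow> complex" and r :: real
    and M :: "'a set \<Rightarrow> real \<Rightarrow> complex" and p :: "'a \<Rightarrow> 'a set \<Rightarrow> complex"
  assumes simple: "simple_graph V E"
    and inj: "inj_on f V"
    and r_pos: "r > 0"
    and discs: "\<And>u v. u \<in> V \<Longrightarrow> v \<in> V \<Longrightarrow> u \<noteq> v \<Longrightarrow> cball (f u) r \<inter> cball (f v) r = {}"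
    and arc_M: "\<And>e. e \<in> E \<Longrightarrow> arc (M e)"
    and ends_M: "\<And>e. e \<in> E \<Longrightarrow> {pathstart (M e), pathfinish (M e)} = (\<lambda>u. p u e) ` e"
    and dist_p: "\<And>e u. e \<in> E \<Longrightarrow> u \<in> e \<Longrightarrow> dist (f u) (p u e) = r"
    and M_disc: "\<And>e u. e \<in> E \<Longrightarrow> u \<in> e \<Longrightarrow> path_image (M e) \<inter> cball (f u) r = {p u e}"
    and M_off: "\<And>e u. e \<in> E \<Longrightarrow> u \<in> V \<Longrightarrow> u \<notin> e \<Longrightarrow> path_image (M e) \<inter> cball (f u) r = {}"
    and M_disjoint: "\<And>e e'. e \<in> E \<Longrightarrow> e' \<in> E \<Longrightarrow> e \<noteq> e' \<Longrightarrow> path_image (M e) \<inter> path_image (M e') = {}"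

text \<open>The radius is constrained by finitely many pairs of vertices and of an edge with a
  vertex off it, and each constraint holds for all small \<open>r > 0\<close>. Of each given arc
  only the stretch between its two discs is kept.\<close>

lemma planar_imp_disc_drawing:
  fixes V :: "'a set"
  assumes "simple_graph V E" "planar V E"
  shows "\<exists>f r M p. disc_drawing V E f r M p"
proof -
  obtain f and \<gamma> :: "'a set \<Rightarrow> real \<Rightarrow> complex" where inj: "inj_on f V"
    and \<gamma>: "\<And>e. e \<in> E \<Longrightarrow> arc (\<gamma> e)" "\<And>e. e \<in> E \<Longrightarrow> {pathstart (\<gamma> e), pathfinish (\<gamma> e)} = f ` e"
      "\<And>e. e \<in> E \<Longrightarrow> path_image (\<gamma> e) \<inter> f ` V = f ` e"
    and \<gamma>2: "\<And>e e'. e \<in> E \<Longrightarrow> e' \<in> E \<Longrightarrow> e \<noteq> e' \<Longrightarrow> path_image (\<gamma> e) \<inter> path_image (\<gamma> e') \<subseteq> f ` (e \<inter> e')"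
    using assms(2) unfolding planar_def by metis
  have fin: "finite V" and edge: "\<And>e. e \<in> E \<Longrightarrow> \<exists>u v. u \<in> V \<and> v \<in> V \<and> u \<noteq> v \<and> e = {u, v}"
    using assms(1) by (auto simp: simple_graph_def)
  have sub: "e \<subseteq> V" if "e \<in> E" for e using edge[OF that] by auto
  have finE: "finite E" using fin sub by (meson PowI finite_Pow_iff finite_subset subsetI)
  have ev1: "\<forall>\<^sub>F r in at_right 0. \<forall>u\<in>V. \<forall>v\<in>V. u \<noteq> v \<longrightarrow> cball (f u) r \<inter> cball (f v) r = {}"
  proof (intro eventually_ball_finite fin ballI)
    fix u v assume uv: "u \<in> V" "v \<in> V"
    show "\<forall>\<^sub>F r in at_right 0. u \<noteq> v \<longrightarrow> cball (f u) r \<inter> cball (f v) r = {}"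
    proof (cases "u = v")
      case False
      then have "dist (f u) (f v) / 2 > 0" using inj uv by (auto simp: inj_on_def)
      then have "\<forall>\<^sub>F r in at_right 0. r < dist (f u) (f v) / 2"
        unfolding eventually_at_right_field by blast
      then show ?thesis
      proof eventually_elim
        case (elim r)
        have "False" if "dist (f u) z \<le> r" "dist (f v) z \<le> r" for z
          using dist_triangle[of "f u" "f v" z] that elim by (simp add: dist_commute)
        then show ?case by auto
      qed
    qed simp
  qed
  have ev2: "\<forall>\<^sub>F r in at_right 0. \<forall>e\<in>E. \<forall>u\<in>V. u \<notin> e \<longrightarrow> path_image (\<gamma> e) \<inter> cball (f u) r = {}"
  proof (intro eventually_ball_finite fin finE ballI)
    fix e u assume eu: "e \<in> E" "u \<in> V"
    show "\<forall>\<^sub>F r in at_right 0. u \<notin> e \<longrightarrow> path_image (\<gamma> e) \<inter> cball (f u) r = {}"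
    proof (cases "u \<in> e")
      case False
      have "f u \<notin> f ` e" using False eu sub inj by (auto simp: inj_on_def)
      then have "f u \<notin> path_image (\<gamma> e)" using \<gamma>(3)[OF eu(1)] eu(2) by blast
      moreover have "open (- path_image (\<gamma> e))"
        using \<gamma>(1)[OF eu(1)] by (simp add: closed_arc_image open_Compl)
      ultimately obtain d where d: "d > 0" "cball (f u) d \<subseteq> - path_image (\<gamma> e)"
        by (meson ComplI open_contains_cball)
      then have "\<forall>\<^sub>F r in at_right 0. r < d" unfolding eventually_at_right_field by blast
      then show ?thesis
      proof eventually_elim
        case (elim r)
        then have "cball (f u) r \<subseteq> cball (f u) d" by (intro subset_cball) simp
        then show ?case using d(2) by blast
      qed
    qed simp
  qed
  have "\<forall>\<^sub>F r in at_right (0::real). r > 0" by (rule eventually_at_right_less)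
  with ev1 ev2 have "\<forall>\<^sub>F r in at_right (0::real). r > 0 \<and>
      (\<forall>u\<in>V. \<forall>v\<in>V. u \<noteq> v \<longrightarrow> cball (f u) r \<inter> cball (f v) r = {}) \<and>
      (\<forall>e\<in>E. \<forall>u\<in>V. u \<notin> e \<longrightarrow> path_image (\<gamma> e) \<inter> cball (f u) r = {})"
    by eventually_elim blast
  then obtain r where r: "r > 0"
      "\<And>u v. u \<in> V \<Longrightarrow> v \<in> V \<Longrightarrow> u \<noteq> v \<Longrightarrow> cball (f u) r \<inter> cball (f v) r = {}"
      "\<And>e u. e \<in> E \<Longrightarrow> u \<in> V \<Longrightarrow> u \<notin> e \<Longrightarrow> path_image (\<gamma> e) \<inter> cball (f u) r = {}"
    using eventually_happens'[OF trivial_limit_at_right_real] by force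
  define Q where "Q e h \<longleftrightarrow> arc h \<and> path_image h \<subseteq> path_image (\<gamma> e) \<and>
      dist (pathstart (\<gamma> e)) (pathstart h) = r \<and> dist (pathfinish (\<gamma> e)) (pathfinish h) = r \<and>
      path_image h \<inter> cball (pathstart (\<gamma> e)) r = {pathstart h} \<and>
      path_image h \<inter> cball (pathfinish (\<gamma> e)) r = {pathfinish h}" for e h
  have "\<exists>h. Q e h" if e: "e \<in> E" for e
  proof -
    obtain u v where uv: "u \<in> V" "v \<in> V" "u \<noteq> v" "e = {u, v}" using edge[OF e] by auto
    have "{pathstart (\<gamma> e), pathfinish (\<gamma> e)} = {f u, f v}" using \<gamma>(2)[OF e] uv(4) by simp
    then have "pathstart (\<gamma> e) = f u \<and> pathfinish (\<gamma> e) = f v \<or> pathstart (\<gamma> e) = f v \<and> pathfinish (\<gamma> e) = f u"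
      by (simp add: doubleton_eq_iff)
    then have "cball (pathstart (\<gamma> e)) r \<inter> cball (pathfinish (\<gamma> e)) r = {}"
      using r(2)[OF uv(1,2,3)] by (auto simp: Int_commute)
    from arc_between_balls[OF \<gamma>(1)[OF e] refl refl r(1) this] show ?thesis unfolding Q_def by metis
  qed
  then obtain M where Q: "\<And>e. e \<in> E \<Longrightarrow> Q e (M e)" by metis
  then have M: "\<And>e. e \<in> E \<Longrightarrow> arc (M e)" "\<And>e. e \<in> E \<Longrightarrow> path_image (M e) \<subseteq> path_image (\<gamma> e)"
      "\<And>e. e \<in> E \<Longrightarrow> dist (pathstart (\<gamma> e)) (pathstart (M e)) = r"
      "\<And>e. e \<in> E \<Longrightarrow> dist (pathfinish (\<gamma> e)) (pathfinish (M e)) = r"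
      "\<And>e. e \<in> E \<Longrightarrow> path_image (M e) \<inter> cball (pathstart (\<gamma> e)) r = {pathstart (M e)}"
      "\<And>e. e \<in> E \<Longrightarrow> path_image (M e) \<inter> cball (pathfinish (\<gamma> e)) r = {pathfinish (M e)}"
    unfolding Q_def by blast+
  \<comment> \<open>The end of \<open>M e\<close> that belongs to \<open>u\<close> is recognised by
    the end of \<open>\<gamma> e\<close> at \<open>f u\<close>; for a vertex off \<open>e\<close>
    the second branch is a mere default.\<close>
  define p where "p = (\<lambda>u e. if f u = pathstart (\<gamma> e) then pathstart (M e) else pathfinish (M e))"
  have ends: "\<exists>u v. u \<in> V \<and> v \<in> V \<and> u \<noteq> v \<and> e = {u, v} \<and> f u = pathstart (\<gamma> e) \<and> f v = pathfinish (\<gamma> e) \<and>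
      p u e = pathstart (M e) \<and> p v e = pathfinish (M e)" if e: "e \<in> E" for e
  proof -
    obtain u v where uv: "u \<in> V" "v \<in> V" "u \<noteq> v" "e = {u, v}" using edge[OF e] by auto
    have ne: "f u \<noteq> f v" using uv inj by (auto simp: inj_on_def)
    have "{pathstart (\<gamma> e), pathfinish (\<gamma> e)} = {f u, f v}" using \<gamma>(2)[OF e] uv(4) by simp
    then consider "pathstart (\<gamma> e) = f u" "pathfinish (\<gamma> e) = f v" | "pathstart (\<gamma> e) = f v" "pathfinish (\<gamma> e) = f u"
      by (auto simp: doubleton_eq_iff)
    then show ?thesis
    proof cases
      case 1
      then have "p u e = pathstart (M e)" "p v e = pathfinish (M e)" using ne by (simp_all add: p_def)
      then show ?thesis using 1 uv by metis
    next
      case 2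
      then have "p v e = pathstart (M e)" "p u e = pathfinish (M e)" using ne by (simp_all add: p_def)
      then show ?thesis using 2 uv by (metis insert_commute)
    qed
  qed
  have dp: "dist (f u) (p u e) = r" if "e \<in> E" "u \<in> e" for e u
    using ends[OF that(1)] M(3,4)[OF that(1)] that(2) by auto
  have Mp: "path_image (M e) \<inter> cball (f u) r = {p u e}" if "e \<in> E" "u \<in> e" for e u
    using ends[OF that(1)] M(5,6)[OF that(1)] that(2) by auto
  have "disc_drawing V E f r M p"
  proof
    show "{pathstart (M e), pathfinish (M e)} = (\<lambda>u. p u e) ` e" if "e \<in> E" for e
      using ends[OF that] by auto
    show "path_image (M e) \<inter> cball (f u) r = {}" if "e \<in> E" "u \<in> V" "u \<notin> e" for e u
      using r(3)[OF that] M(2)[OF that(1)] by blast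
    show "path_image (M e) \<inter> path_image (M e') = {}" if e: "e \<in> E" "e' \<in> E" "e \<noteq> e'" for e e'
    proof -
      \<comment> \<open>Given arcs meet only at images of common ends. These are centres of discs,
        and a middle arc gets no further than the circles around its ends.\<close>
      have "f u \<notin> path_image (M e)" if "u \<in> e" for u
      proof
        assume "f u \<in> path_image (M e)"
        then have "f u \<in> path_image (M e) \<inter> cball (f u) r" using r(1) by simp
        then have "f u = p u e" using Mp[OF e(1) that] by simp
        then show False using dp[OF e(1) that] r(1) by simp
      qed
      then show ?thesis using \<gamma>2[OF e] M(2)[OF e(1)] M(2)[OF e(2)] by blast
    qed
    show "cball (f u) r \<inter> cball (f v) r = {}" if "u \<in> V" "v \<in> V" "u \<noteq> v" for u v
      by (rule r(2)[OF that])
    show "arc (M e)" if "e \<in> E" for e by (rule M(1)[OF that])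
    show "dist (f u) (p u e) = r" if "e \<in> E" "u \<in> e" for e u by (rule dp[OF that])
    show "path_image (M e) \<inter> cball (f u) r = {p u e}" if "e \<in> E" "u \<in> e" for e u
      by (rule Mp[OF that])
  qed (fact assms(1) inj r(1))+
  then show ?thesis by blast
qed

context disc_drawing
begin

lemma finite_V: "finite V"
  using simple by (simp add: simple_graph_def)

lemma edgeE:
  assumes "e \<in> E"
  obtains u v where "u \<in> V" "v \<in> V" "u \<noteq> v" "e = {u, v}"
  using assms simple unfolding simple_graph_def by blast

lemma edge_subset: "e \<in> E \<Longrightarrow> e \<subseteq> V"
  by (elim edgeE) auto

lemma edge_neq: "{u, v} \<in> E \<Longrightarrow> u \<noteq> v"
  by (elim edgeE) (auto simp: doubleton_eq_iff)

lemma edge_in_V: "{u, v} \<in> E \<Longrightarrow> u \<in> V \<and> v \<in> V"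
  using edge_subset by blast

lemma finite_E: "finite E"
  using finite_V edge_subset by (meson PowI finite_Pow_iff finite_subset subsetI)

lemma p_in_M: "e \<in> E \<Longrightarrow> u \<in> e \<Longrightarrow> p u e \<in> path_image (M e)"
  using M_disc by blast

lemma p_eq_iff:
  assumes "e \<in> E" "e' \<in> E" "u \<in> e" "u \<in> e'"
  shows "p u e = p u e' \<longleftrightarrow> e = e'"
  using assms M_disjoint[of e e'] p_in_M[of e u] p_in_M[of e' u] by (metis disjoint_iff)

section \<open>The redrawn edges and their intersections\<close>

definition radius :: "'a \<Rightarrow> 'a set \<Rightarrow> complex set" where
  "radius u e = closed_segment (f u) (p u e)"

text \<open>The redrawn edge, kept as a point set so that intersections can be computed piece by
  piece; \<open>edge_arc\<close> supplies parametrisations.\<close>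

definition L :: "'a set \<Rightarrow> complex set" where
  "L e = path_image (M e) \<union> (\<Union>u\<in>e. radius u e)"

lemma radius_cball: "e \<in> E \<Longrightarrow> u \<in> e \<Longrightarrow> radius u e \<subseteq> cball (f u) r"
  unfolding radius_def using dist_p[of e u] r_pos by (intro closed_segment_subset) auto

lemma radius_sphere:
  assumes "e \<in> E" "u \<in> e" "z \<in> radius u e" "dist (f u) z = r"
  shows "z = p u e"
proof -
  obtain t where t: "0 \<le> t" "t \<le> 1" "z = (1 - t) *\<^sub>R f u + t *\<^sub>R p u e"
    using assms(3) unfolding radius_def in_segment by blast
  have "z - f u = t *\<^sub>R (p u e - f u)" using t(3) by (simp add: algebra_simps)
  then have "dist (f u) z = t * dist (f u) (p u e)"
    using t(1) by (metis abs_of_nonneg dist_commute dist_norm norm_scaleR)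
  then have "t = 1" using assms(4) dist_p[OF assms(1,2)] r_pos by simp
  then show ?thesis using t(3) by simp
qed

lemma radius_Int_radius:
  assumes "e \<in> E" "e' \<in> E" "u \<in> e" "u \<in> e'" "e \<noteq> e'"
  shows "radius u e \<inter> radius u e' = {f u}"
proof -
  have "z = f u" if z: "z \<in> radius u e" "z \<in> radius u e'" for z
  proof (rule ccontr)
    assume "z \<noteq> f u"
    obtain s where s: "0 \<le> s" "z = (1 - s) *\<^sub>R f u + s *\<^sub>R p u e"
      using z(1) unfolding radius_def in_segment by blast
    obtain t where t: "0 \<le> t" "z = (1 - t) *\<^sub>R f u + t *\<^sub>R p u e'"
      using z(2) unfolding radius_def in_segment by blast
    have *: "z - f u = s *\<^sub>R (p u e - f u)"
      unfolding s(2) by (simp add: algebra_simps)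
    have **: "z - f u = t *\<^sub>R (p u e' - f u)"
      unfolding t(2) by (simp add: algebra_simps)
    have n: "norm (p u e - f u) = r" "norm (p u e' - f u) = r"
      using dist_p assms by (metis dist_commute dist_norm)+
    have "norm (z - f u) = s * r" "norm (z - f u) = t * r"
      using arg_cong[OF *, of norm] arg_cong[OF **, of norm] n s(1) t(1) by simp_all
    then have "s = t" using r_pos by simp
    moreover have "s \<noteq> 0" using * \<open>z \<noteq> f u\<close> by auto
    ultimately have "p u e = p u e'" using * ** by simp
    then show False using p_eq_iff assms by blast
  qed
  then show ?thesis by (auto simp: radius_def)
qed

lemma M_Int_radius:
  assumes "e \<in> E" "e' \<in> E" "u \<in> e'" "e \<noteq> e'"
  shows "path_image (M e) \<inter> radius u e' = {}"
proof -
  have uV: "u \<in> V" using assms edge_subset by blast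
  have False if z: "z \<in> path_image (M e)" "z \<in> radius u e'" for z
  proof -
    have zc: "z \<in> path_image (M e) \<inter> cball (f u) r" using z radius_cball assms by blast
    show False
    proof (cases "u \<in> e")
      case True
      then have "z = p u e" using zc M_disc[OF assms(1) True] by simp
      moreover from this have "z = p u e'"
        using radius_sphere[OF assms(2,3) z(2)] dist_p[OF assms(1) True] by simp
      ultimately show False using p_eq_iff[OF assms(1,2) True assms(3)] assms(4) by simp
    next
      case False
      then show False using zc M_off[OF assms(1) uV False] by simp
    qed
  qed
  then show ?thesis by blast
qed

lemma M_Int_own_radius:
  assumes "e \<in> E" "u \<in> e"
  shows "path_image (M e) \<inter> radius u e = {p u e}"
  using M_disc[OF assms] radius_cball[OF assms] p_in_M[OF assms] by (auto simp: radius_def)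

lemma radius_disjoint:
  assumes "e \<in> E" "e' \<in> E" "u \<in> e" "v \<in> e'" "u \<noteq> v"
  shows "radius u e \<inter> radius v e' = {}"
proof -
  have "u \<in> V" "v \<in> V" using assms edge_subset by blast+
  then show ?thesis using discs[of u v] radius_cball assms by blast
qed

text \<open>The redrawing is again a plane drawing: pieces of different edges meet only if they are
  radii of one disc, and such radii share just the centre.\<close>

lemma L_Int:
  assumes "e \<in> E" "e' \<in> E" "e \<noteq> e'"
  shows "L e \<inter> L e' \<subseteq> f ` (e \<inter> e')"
proof
  fix z assume "z \<in> L e \<inter> L e'"
  then consider "z \<in> path_image (M e)" "z \<in> path_image (M e')"
    | u where "u \<in> e'" "z \<in> path_image (M e)" "z \<in> radius u e'"
    | u where "u \<in> e" "z \<in> radius u e" "z \<in> path_image (M e')"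
    | u v where "u \<in> e" "v \<in> e'" "z \<in> radius u e" "z \<in> radius v e'"
    by (auto simp: L_def)
  then show "z \<in> f ` (e \<inter> e')"
  proof cases
    case 1
    then show ?thesis using M_disjoint[OF assms] by blast
  next
    case 2
    then show ?thesis using M_Int_radius[OF assms(1,2)] assms(3) by blast
  next
    case 3
    then show ?thesis using M_Int_radius[OF assms(2,1)] assms(3) by blast
  next
    case (4 u v)
    show ?thesis
    proof (cases "u = v")
      case True
      then have "z = f u" using radius_Int_radius[OF assms(1,2)] 4 assms(3) by blast
      then show ?thesis using 4 True by blast
    next
      case False
      then show ?thesis using radius_disjoint[OF assms(1,2)] 4 by blast
    qed
  qed
qed

lemma L_cball:
  assumes "e \<in> E" "u \<in> e"
  shows "L e \<inter> cball (f u) r = radius u e"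
proof -
  have "radius v e \<inter> cball (f u) r = {}" if "v \<in> e" "v \<noteq> u" for v
    using radius_cball[OF assms(1) that(1)] discs[of v u] edge_subset[OF assms(1)] that assms(2) by blast
  moreover have "path_image (M e) \<inter> cball (f u) r \<subseteq> radius u e"
    unfolding M_disc[OF assms] by (simp add: radius_def)
  ultimately show ?thesis unfolding L_def using radius_cball[OF assms] assms(2) by blast
qed

lemma L_cball_other:
  assumes "e \<in> E" "u \<in> V" "u \<notin> e"
  shows "L e \<inter> cball (f u) r = {}"
proof -
  have "radius v e \<inter> cball (f u) r = {}" if "v \<in> e" for v
    using radius_cball[OF assms(1) that(1)] discs[of v u] edge_subset[OF assms(1)] that assms by blast
  then show ?thesis unfolding L_def using M_off[OF assms] by blast
qed

lemma vertex_in_L: "u \<in> e \<Longrightarrow> f u \<in> L e"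
  by (auto simp: L_def radius_def)

lemma vertex_in_L_iff: "e \<in> E \<Longrightarrow> u \<in> V \<Longrightarrow> f u \<in> L e \<longleftrightarrow> u \<in> e"
  using vertex_in_L L_cball_other[of e u] r_pos by (cases "u \<in> e") auto

lemma edge_arc:
  assumes "{u, v} \<in> E"
  obtains g where "arc g" "pathstart g = f u" "pathfinish g = f v" "path_image g = L {u, v}"
proof -
  let ?e = "{u, v}"
  have uv: "u \<noteq> v" "u \<in> V" "v \<in> V" using assms edge_neq edge_in_V by blast+
  have "\<exists>h. arc h \<and> path_image h = path_image (M ?e) \<and> pathstart h = p u ?e \<and> pathfinish h = p v ?e"
  proof -
    have "{pathstart (M ?e), pathfinish (M ?e)} = {p u ?e, p v ?e}" using ends_M[OF assms] by simp
    then consider "pathstart (M ?e) = p u ?e" "pathfinish (M ?e) = p v ?e"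
      | "pathstart (M ?e) = p v ?e" "pathfinish (M ?e) = p u ?e"
      by (auto simp: doubleton_eq_iff)
    then show ?thesis
    proof cases
      case 1
      then show ?thesis using arc_M[OF assms] by blast
    next
      case 2
      then show ?thesis using arc_M[OF assms]
        by (intro exI[of _ "reversepath (M ?e)"]) (simp add: arc_reversepath)
    qed
  qed
  then obtain h where h: "arc h" "path_image h = path_image (M ?e)" "pathstart h = p u ?e" "pathfinish h = p v ?e"
    by blast
  have pu: "f u \<noteq> p u ?e" "p v ?e \<noteq> f v"
    using dist_p[OF assms, of u] dist_p[OF assms, of v] r_pos by auto
  have "arc (linepath (f u) (p u ?e) +++ h)"
  proof (rule arc_join)
    show "path_image (linepath (f u) (p u ?e)) \<inter> path_image h \<subseteq> {pathstart h}"
      using M_Int_own_radius[OF assms, of u] h by (auto simp: radius_def)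
  qed (use pu h in auto)
  moreover have "arc ((linepath (f u) (p u ?e) +++ h) +++ linepath (p v ?e) (f v))"
  proof (rule arc_join)
    have "radius u ?e \<inter> radius v ?e = {}" using radius_disjoint[OF assms assms] uv by blast
    then show "path_image (linepath (f u) (p u ?e) +++ h) \<inter> path_image (linepath (p v ?e) (f v))
        \<subseteq> {pathstart (linepath (p v ?e) (f v))}"
      using M_Int_own_radius[OF assms, of v] h
      by (auto simp: path_image_join radius_def closed_segment_commute[of "p v ?e"])
  qed (use calculation pu h in auto)
  moreover have "path_image ((linepath (f u) (p u ?e) +++ h) +++ linepath (p v ?e) (f v)) = L ?e"
    using h by (auto simp: path_image_join L_def radius_def closed_segment_commute[of "p v ?e"])
  ultimately show ?thesis
    using that[of "(linepath (f u) (p u ?e) +++ h) +++ linepath (p v ?e) (f v)"] by simp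
qed

section \<open>Triangles as Jordan curves and the vertices they separate\<close>

definition tri :: "'a \<Rightarrow> 'a \<Rightarrow> 'a \<Rightarrow> complex set" where
  "tri a b c = L {a, b} \<union> L {b, c} \<union> L {c, a}"

lemma tri_curve:
  assumes "{a, b} \<in> E" "{b, c} \<in> E" "{c, a} \<in> E"
  obtains g where "simple_path g" "pathfinish g = pathstart g" "path_image g = tri a b c"
proof -
  have ne: "a \<noteq> b" "b \<noteq> c" "c \<noteq> a" using assms edge_neq by blast+
  obtain g1 where g1: "arc g1" "pathstart g1 = f a" "pathfinish g1 = f b" "path_image g1 = L {a, b}"
    using edge_arc[OF assms(1)] .
  obtain g2 where g2: "arc g2" "pathstart g2 = f b" "pathfinish g2 = f c" "path_image g2 = L {b, c}"
    using edge_arc[OF assms(2)] .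
  obtain g3 where g3: "arc g3" "pathstart g3 = f c" "pathfinish g3 = f a" "path_image g3 = L {c, a}"
    using edge_arc[OF assms(3)] .
  have "L {a, b} \<inter> L {b, c} \<subseteq> f ` ({a, b} \<inter> {b, c})"
    using ne by (intro L_Int assms) (auto simp: doubleton_eq_iff)
  then have I12: "L {a, b} \<inter> L {b, c} \<subseteq> {f b}" using ne by auto
  have "L {a, b} \<inter> L {c, a} \<subseteq> f ` ({a, b} \<inter> {c, a})"
    using ne by (intro L_Int assms) (auto simp: doubleton_eq_iff)
  then have I13: "L {a, b} \<inter> L {c, a} \<subseteq> {f a}" using ne by auto
  have "L {b, c} \<inter> L {c, a} \<subseteq> f ` ({b, c} \<inter> {c, a})"
    using ne by (intro L_Int assms) (auto simp: doubleton_eq_iff)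
  then have I23: "L {b, c} \<inter> L {c, a} \<subseteq> {f c}" using ne by auto
  have 12: "arc (g1 +++ g2)" using g1 g2 I12 by (intro arc_join) auto
  have im: "path_image (g1 +++ g2) = L {a, b} \<union> L {b, c}" using g1 g2 by (simp add: path_image_join)
  have "simple_path ((g1 +++ g2) +++ g3)"
    using 12 g1 g2 g3 im I13 I23 by (intro simple_path_join_loop) auto
  moreover have "path_image ((g1 +++ g2) +++ g3) = tri a b c"
    using g1 g2 g3 im by (simp add: path_image_join tri_def)
  moreover have "pathfinish ((g1 +++ g2) +++ g3) = pathstart ((g1 +++ g2) +++ g3)"
    using g1 g3 by simp
  ultimately show ?thesis using that by blast
qed

lemma tri_cball:
  assumes "{a, b} \<in> E" "{b, c} \<in> E" "{c, a} \<in> E"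
  shows "tri a b c \<inter> cball (f a) r = radius a {a, b} \<union> radius a {c, a}"
proof -
  have ne: "a \<noteq> b" "b \<noteq> c" "c \<noteq> a" "a \<in> V" using assms edge_neq edge_in_V by blast+
  then have "L {b, c} \<inter> cball (f a) r = {}" using assms by (intro L_cball_other) auto
  then show ?thesis using L_cball[OF assms(1), of a] L_cball[OF assms(3), of a] by (auto simp: tri_def)
qed

text \<open>The edge \<open>e\<close> without the end radius at its other vertex: a connected set joining \<open>f d\<close> to the circle
  around that vertex.\<close>

lemma edge_tail_connected:
  assumes "e \<in> E" "d \<in> e"
  shows "connected (path_image (M e) \<union> radius d e)"
  using assms M_Int_own_radius[OF assms] arc_M[OF assms(1)]
  by (intro connected_Un) (auto simp: radius_def connected_arc_image)

text \<open>The edge \<open>ad\<close> meets the triangle only in \<open>f a\<close>, and the edge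
  without its radius at \<open>a\<close> avoids that point. So the side of the triangle on which
  \<open>d\<close> lies can be tested on the circle around \<open>f a\<close>.\<close>

lemma tri_adjacent_tail:
  assumes abc: "{a, b} \<in> E" "{b, c} \<in> E" "{c, a} \<in> E"
    and ad: "{a, d} \<in> E" "d \<noteq> b" "d \<noteq> c"
  shows "connected_component (- tri a b c) (f d) (p a {a, d})"
proof -
  let ?e = "{a, d}"
  have ne: "a \<noteq> b" "b \<noteq> c" "c \<noteq> a" "a \<noteq> d" using abc ad edge_neq by blast+
  have "L ?e \<inter> L {a, b} \<subseteq> f ` (?e \<inter> {a, b})" "L ?e \<inter> L {b, c} \<subseteq> f ` (?e \<inter> {b, c})"
    "L ?e \<inter> L {c, a} \<subseteq> f ` (?e \<inter> {c, a})"
    using ne ad by (intro L_Int abc ad(1); force simp: doubleton_eq_iff)+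
  then have "L ?e \<inter> tri a b c \<subseteq> {f a}"
    using ne ad unfolding tri_def by auto
  moreover have "path_image (M ?e) \<union> radius d ?e \<subseteq> L ?e" by (auto simp: L_def)
  moreover have "f a \<notin> path_image (M ?e)"
    using M_disc[OF ad(1), of a] dist_p[OF ad(1), of a] r_pos by auto
  moreover have "f a \<notin> radius d ?e"
    using radius_disjoint[OF ad(1) ad(1), of a d] ne by (auto simp: radius_def)
  ultimately have "path_image (M ?e) \<union> radius d ?e \<subseteq> - tri a b c" by blast
  moreover have "connected (path_image (M ?e) \<union> radius d ?e)"
    using ad by (intro edge_tail_connected) auto
  moreover have "f d \<in> radius d ?e" by (simp add: radius_def)
  moreover have "p a ?e \<in> path_image (M ?e)" using ad by (intro p_in_M) auto
  ultimately show ?thesis unfolding connected_component_def by blast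
qed

text \<open>Both vertices are moved along their edges to the circle around \<open>f a\<close>. There
  the triangle looks like two radii, the negative product puts the two points in different sectors,
  and \<open>Jordan_corner\<close> applies.\<close>

lemma corner_separates:
  assumes abc: "{a, b} \<in> E" "{b, c} \<in> E" "{c, a} \<in> E"
    and d: "{a, d} \<in> E" "d \<noteq> b" "d \<noteq> c" and e: "{a, e} \<in> E" "e \<noteq> b" "e \<noteq> c"
    and o: "orient (p a {a, b}) (p a {a, c}) (p a {a, d}) * orient (p a {a, b}) (p a {a, c}) (p a {a, e}) < 0"
  shows "\<not> connected_component (- tri a b c) (f d) (f e)"
proof
  assume fde: "connected_component (- tri a b c) (f d) (f e)"
  have ne: "a \<noteq> b" "b \<noteq> c" "c \<noteq> a" using abc edge_neq by blast+
  have ac: "{a, c} \<in> E" using abc(3) by (simp add: insert_commute)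
  obtain g where g: "simple_path g" "pathfinish g = pathstart g" "path_image g = tri a b c"
    using tri_curve[OF abc] .
  have pp: "p a {a, b} \<noteq> p a {a, c}"
    using p_eq_iff[OF abc(1) ac, of a] ne by (auto simp: doubleton_eq_iff)
  have S: "path_image g \<inter> cball (f a) r = closed_segment (f a) (p a {a, b}) \<union> closed_segment (f a) (p a {a, c})"
    using tri_cball[OF abc] g(3) by (simp add: radius_def insert_commute)
  have dp: "dist (f a) (p a {a, x}) = r" if "{a, x} \<in> E" for x using dist_p[OF that, of a] by simp
  have pa: "p a {a, x} \<noteq> f a" if "{a, x} \<in> E" for x using dp[OF that] r_pos by auto
  have no: False if x: "{a, x} \<in> E" "orient (p a {a, b}) (p a {a, c}) (p a {a, x}) < 0"
    and y: "{a, y} \<in> E" "orient (p a {a, b}) (p a {a, c}) (p a {a, y}) > 0"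
    and xy: "connected_component (- tri a b c) (p a {a, x}) (p a {a, y})" for x y
    using Jordan_corner[OF g(1,2) r_pos dp[OF abc(1)] dp[OF ac] pp S dp[OF x(1)] x(2)
        ends_in_segment(2) pa[OF x(1)] dp[OF y(1)] y(2) ends_in_segment(2) pa[OF y(1)]] xy g(3)
    by simp
  have de: "connected_component (- tri a b c) (p a {a, d}) (p a {a, e})"
    using tri_adjacent_tail[OF abc d] tri_adjacent_tail[OF abc e] fde
    by (metis connected_component_sym connected_component_trans)
  show False
    using o no[OF d(1) _ e(1) _ de] no[OF e(1) _ d(1) _ connected_component_sym[OF de]]
    by (auto simp: mult_less_0_iff)
qed

text \<open>The counterpart of \<open>corner_separates\<close>: an edge without a common end with
  the triangle misses the whole curve. Played against each other, the two lemmas exclude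
  configurations of radii.\<close>

lemma tri_edge_connected:
  assumes abc: "{a, b} \<in> E" "{b, c} \<in> E" "{c, a} \<in> E"
    and de: "{d, e} \<in> E" "d \<notin> {a, b, c}" "e \<notin> {a, b, c}"
  shows "connected_component (- tri a b c) (f d) (f e)"
proof -
  have "L {d, e} \<inter> L x = {}" if "x \<in> {{a, b}, {b, c}, {c, a}}" for x
    using L_Int[OF de(1), of x] that abc de(2,3) by fastforce
  then have "L {d, e} \<subseteq> - tri a b c" unfolding tri_def by blast
  moreover obtain g where "arc g" "path_image g = L {d, e}" using edge_arc[OF de(1)] by metis
  then have "connected (L {d, e})" by (metis connected_arc_image)
  ultimately show ?thesis
    unfolding connected_component_def using vertex_in_L[of d "{d, e}"] vertex_in_L[of e "{d, e}"] by blast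
qed

text \<open>Crossing chords put \<open>x\<close> and \<open>y\<close> in different sectors at the
  corner \<open>u\<close> of the triangle \<open>uvw\<close>, although the edge \<open>xy\<close>
  avoids this triangle.\<close>

lemma corner_chords_disjoint:
  assumes E: "{u, v} \<in> E" "{u, w} \<in> E" "{v, w} \<in> E" "{u, x} \<in> E" "{u, y} \<in> E" "{x, y} \<in> E"
    and ne: "x \<noteq> v" "x \<noteq> w" "y \<noteq> v" "y \<noteq> w"
  shows "closed_segment (p u {u, v}) (p u {u, w}) \<inter> closed_segment (p u {u, x}) (p u {u, y}) = {}"
proof (rule ccontr)
  assume *: "\<not> ?thesis"
  have nu: "u \<noteq> v" "u \<noteq> w" "u \<noteq> x" "u \<noteq> y" "v \<noteq> w" "x \<noteq> y" using E edge_neq by blast+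
  have wu: "{w, u} \<in> E" using E(2) by (simp add: insert_commute)
  have pd: "p u {u, a} \<noteq> p u {u, b}" if "{u, a} \<in> E" "{u, b} \<in> E" "a \<noteq> b" for a b
    using p_eq_iff[OF that(1,2), of u] that(3) by (auto simp: doubleton_eq_iff)
  have dp: "dist (f u) (p u {u, x}) = r" if "{u, x} \<in> E" for x using dist_p[OF that, of u] by simp
  have o: "orient (p u {u, v}) (p u {u, w}) (p u {u, z}) \<noteq> 0" if "{u, z} \<in> E" "z \<noteq> v" "z \<noteq> w" for z
    using that E nu by (intro orient_circle_nonzero[of "f u" _ r] dp pd) auto
  have "orient (p u {u, v}) (p u {u, w}) (p u {u, x}) * orient (p u {u, v}) (p u {u, w}) (p u {u, y}) < 0"
    using * o[OF E(4)] o[OF E(5)] ne by (intro crossing_segments_orient) auto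
  then have "\<not> connected_component (- tri u v w) (f x) (f y)"
    using E wu ne by (intro corner_separates) auto
  moreover have "connected_component (- tri u v w) (f x) (f y)"
    using E wu ne nu by (intro tri_edge_connected) auto
  ultimately show False by blast
qed

text \<open>Among the radii at \<open>a\<close> towards \<open>c\<close>, \<open>d\<close>, \<open>e\<close>, one is the middle one in the order starting at \<open>b\<close>. If it is \<open>d\<close>
  or \<open>e\<close>, then the corresponding triangle separates the ends of the edge \<open>ce\<close> or \<open>cd\<close>; so it is \<open>c\<close>.\<close>

lemma K5_minus_edge_separates:
  assumes abc: "{a, b} \<in> E" "{b, c} \<in> E" "{c, a} \<in> E"
    and d: "{a, d} \<in> E" "{b, d} \<in> E" "{c, d} \<in> E"
    and e: "{a, e} \<in> E" "{b, e} \<in> E" "{c, e} \<in> E" and "d \<noteq> e"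
  shows "\<not> connected_component (- tri a b c) (f d) (f e)"
proof -
  have ne: "a \<noteq> b" "b \<noteq> c" "c \<noteq> a" "a \<noteq> d" "b \<noteq> d" "c \<noteq> d" "a \<noteq> e" "b \<noteq> e" "c \<noteq> e"
    using abc d e edge_neq by blast+
  have ac: "{a, c} \<in> E" and da: "{d, a} \<in> E" and ea: "{e, a} \<in> E"
    using abc d e by (simp_all add: insert_commute)
  have pd: "p a {a, x} \<noteq> p a {a, y}" if "{a, x} \<in> E" "{a, y} \<in> E" "x \<noteq> y" for x y
    using p_eq_iff[OF that(1,2), of a] that(3) by (auto simp: doubleton_eq_iff)
  have dp: "dist (f a) (p a {a, x}) = r" if "{a, x} \<in> E" for x using dist_p[OF that, of a] by simp
  define ori where "ori x y z = orient (p a {a, x}) (p a {a, y}) (p a {a, z})" for x y z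
  have ori: "ori x y z \<noteq> 0" if "{a, x} \<in> E" "{a, y} \<in> E" "{a, z} \<in> E" "x \<noteq> y" "x \<noteq> z" "y \<noteq> z" for x y z
    unfolding ori_def using that by (intro orient_circle_nonzero[of "f a" _ r] dp pd) auto
  have sw: "ori x z y = - ori x y z" for x y z unfolding ori_def by (rule orient_swap)
  \<comment> \<open>To be used with \<open>x\<close>, \<open>y\<close>, \<open>z\<close> the
    orientations of the pairs \<open>cd\<close>, \<open>ce\<close>, \<open>de\<close> as seen from
    \<open>b\<close>; exchanging the members of a pair flips the sign. The two negated premises say
    that neither \<open>abd\<close> nor \<open>abe\<close> separates the ends of an edge.\<close>
  have signs: "x * y < 0" if "\<not> - x * z < 0" "\<not> y * z < 0" "x \<noteq> 0" "y \<noteq> 0" "z \<noteq> 0" for x y z :: real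
    using that by (cases x "0 :: real" rule: linorder_cases; cases y "0 :: real" rule: linorder_cases;
        cases z "0 :: real" rule: linorder_cases) (auto simp: mult_less_0_iff zero_less_mult_iff)
  have "\<not> ori b d c * ori b d e < 0"
    using corner_separates[of a b d c e] tri_edge_connected[of a b d c e] abc d e da ac ne \<open>d \<noteq> e\<close>
    unfolding ori_def by auto
  moreover have "\<not> ori b e c * ori b e d < 0"
    using corner_separates[of a b e c d] tri_edge_connected[of a b e c d] abc d e ea ac ne \<open>d \<noteq> e\<close>
    unfolding ori_def by auto
  moreover have "ori b c d \<noteq> 0" "ori b c e \<noteq> 0" "ori b d e \<noteq> 0"
    using ori[of b c d] ori[of b c e] ori[of b d e] abc ac d e ne \<open>d \<noteq> e\<close> by simp_all
  ultimately have "ori b c d * ori b c e < 0"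
    using signs[of "ori b c d" "ori b d e" "ori b c e"] sw[of b c d] sw[of b c e] sw[of b d e] by simp
  then show ?thesis
    using abc d e ne unfolding ori_def by (intro corner_separates) auto
qed

end

section \<open>Sliding tokens on edges\<close>

lemma k_cliques_2:
  assumes "simple_graph V E"
  shows "k_cliques V E 2 = E"
proof
  show "k_cliques V E 2 \<subseteq> E"
    by (auto simp: k_cliques_def clique_def card_2_iff)
  show "E \<subseteq> k_cliques V E 2"
    using assms by (fastforce simp: k_cliques_def clique_def simple_graph_def card_2_iff insert_commute)
qed

lemma TS_edges_2E:
  assumes "simple_graph V E" "ee \<in> TS_edges V E 2"
  obtains u v w where "ee = {{u, v}, {u, w}}" "{u, v} \<in> E" "{u, w} \<in> E" "{v, w} \<in> E"
proof -
  obtain C C' where CC: "ee = {C, C'}" "C \<in> k_cliques V E 2" "C' \<in> k_cliques V E 2"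
    "\<exists>v w. C - C' = {v} \<and> C' - C = {w} \<and> {v, w} \<in> E"
    using assms(2) unfolding TS_edges_def mem_Collect_eq by metis
  then obtain v w where vw: "C - C' = {v}" "C' - C = {w}" "{v, w} \<in> E" by (elim exE conjE)
  have C: "ee = {C, C'}" "C \<in> E" "C' \<in> E" "C - C' = {v}" "C' - C = {w}" "{v, w} \<in> E"
    using CC(1-3) vw k_cliques_2[OF assms(1)] by blast+
  have "card C = 2" "card C' = 2" using CC(2,3) by (simp_all add: k_cliques_def)
  have pair: "\<exists>b. X = {a, b} \<and> a \<noteq> b" if "card X = 2" "a \<in> X" for X :: "'a set" and a
    using that unfolding card_2_iff by (metis insert_commute insert_iff singletonD)
  obtain u where u: "C = {v, u}" "v \<noteq> u"
    using pair[OF \<open>card C = 2\<close>, of v] vw(1) by blast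
  obtain u' where u': "C' = {w, u'}" "w \<noteq> u'"
    using pair[OF \<open>card C' = 2\<close>, of w] vw(2) by blast
  have "u \<in> C'" using u vw(1) by (metis DiffI insertI1 insert_commute singletonD)
  moreover have "u \<noteq> w" using u(1) vw(2) by (metis DiffD2 insertI1 insert_commute)
  ultimately have "u' = u" using u' by blast
  then show ?thesis using that[of u v w] C u u' by (simp add: insert_commute)
qed

context disc_drawing
begin

section \<open>Chords in the discs and their images after the collapse\<close>

lemma p_neq: "{u, v} \<in> E \<Longrightarrow> {u, w} \<in> E \<Longrightarrow> v \<noteq> w \<Longrightarrow> p u {u, v} \<noteq> p u {u, w}"
  using p_eq_iff[of "{u, v}" "{u, w}" u] by (auto simp: doubleton_eq_iff)

lemma orient_p_nonzero:
  assumes "{u, x} \<in> E" "{u, y} \<in> E" "{u, z} \<in> E" "x \<noteq> y" "x \<noteq> z" "y \<noteq> z"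
  shows "orient (p u {u, x}) (p u {u, y}) (p u {u, z}) \<noteq> 0"
  using assms by (intro orient_circle_nonzero[of "f u" _ r] p_neq dist_p) auto

definition chord :: "'a \<Rightarrow> 'a \<Rightarrow> 'a \<Rightarrow> complex set" where
  "chord u v w = closed_segment (p u {u, v}) (p u {u, w})"

lemma chord_commute: "chord u v w = chord u w v"
  by (simp add: chord_def closed_segment_commute)

lemma chord_cball:
  assumes "{u, v} \<in> E" "{u, w} \<in> E"
  shows "chord u v w \<subseteq> cball (f u) r"
  unfolding chord_def using dist_p[OF assms(1), of u] dist_p[OF assms(2), of u]
  by (intro closed_segment_subset) auto

text \<open>A middle arc reaches the disc only at a point of the circle, and a chord contains no
  third such point by non-collinearity. Hence collapsing a middle arc identifies no two points of a
  chord.\<close>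

lemma chord_Int_M:
  assumes "{u, v} \<in> E" "{u, w} \<in> E" "v \<noteq> w" "e \<in> E" "z \<in> chord u v w" "z \<in> path_image (M e)"
  shows "e \<in> {{u, v}, {u, w}} \<and> z = p u e"
proof -
  have z: "z \<in> path_image (M e) \<inter> cball (f u) r" using assms chord_cball by blast
  have "u \<in> V" using assms(1) edge_in_V by blast
  then have ue: "u \<in> e" using M_off[OF assms(4)] z by blast
  then have zp: "z = p u e" using M_disc[OF assms(4)] z by blast
  obtain x where x: "e = {u, x}" using ue assms(4) by (elim edgeE) auto
  have "x = v \<or> x = w"
  proof (rule ccontr)
    assume "\<not> ?thesis"
    then have "orient (p u {u, v}) (p u {u, w}) (p u {u, x}) \<noteq> 0"
      using assms x by (intro orient_p_nonzero) auto
    then show False using orient_segment assms(5) unfolding chord_def zp x by blast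
  qed
  then show ?thesis using x zp by blast
qed

text \<open>Two different reasons are at work: chords with a common end are kept apart by the
  non-collinearity of three points of a circle, chords with four distinct ends by planarity.\<close>

lemma chords_meet:
  assumes 1: "{u, v} \<in> E" "{u, w} \<in> E" "{v, w} \<in> E" and 2: "{u, x} \<in> E" "{u, y} \<in> E" "{x, y} \<in> E"
    and ne: "{v, w} \<noteq> {x, y}" and z: "z \<in> chord u v w" "z \<in> chord u x y"
  shows "\<exists>t. t \<in> {v, w} \<and> t \<in> {x, y} \<and> z = p u {u, t}"
proof -
  have com: "z = p u {u, a}" if "{u, a} \<in> E" "{u, b} \<in> E" "{u, c} \<in> E" "a \<noteq> b" "a \<noteq> c" "b \<noteq> c"
    "z \<in> chord u a b" "z \<in> chord u a c" for a b c
    using segments_common_end orient_p_nonzero[OF that(1-6)] that(7,8) unfolding chord_def by blast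
  have d: "v \<noteq> w" "x \<noteq> y" using 1(3) 2(3) edge_neq by blast+
  consider "v = x" | "v = y" | "w = x" | "w = y" | "x \<noteq> v" "x \<noteq> w" "y \<noteq> v" "y \<noteq> w" by blast
  then show ?thesis
  proof cases
    case 1
    then have "w \<noteq> y" using ne by auto
    then have "z = p u {u, v}" using com[of v w y] assms d 1 by simp
    then show ?thesis using 1 by blast
  next
    case 2
    then have "w \<noteq> x" using ne by auto
    then have "z = p u {u, v}" using com[of v w x] assms d 2 by (simp add: chord_commute[of u x])
    then show ?thesis using 2 by blast
  next
    case 3
    then have "v \<noteq> y" using ne by auto
    then have "z = p u {u, w}" using com[of w v y] assms d 3 by (simp add: chord_commute[of u v])
    then show ?thesis using 3 by blast
  next
    case 4
    then have "v \<noteq> x" using ne by auto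
    then have "z = p u {u, w}" using com[of w v x] assms d 4 
      by (simp add: chord_commute[of u v] chord_commute[of u x])
    then show ?thesis using 4 by blast
  next
    case 5
    then show ?thesis using corner_chords_disjoint[OF 1 2] z unfolding chord_def by blast
  qed
qed

lemma planar_TS_2: "planar (k_cliques V E 2) (TS_edges V E 2)"
proof -
  obtain q :: "complex \<Rightarrow> complex" where q: "continuous_on UNIV q"
    "\<And>z w. q z = q w \<longleftrightarrow> z = w \<or> (\<exists>e\<in>E. z \<in> path_image (M e) \<and> w \<in> path_image (M e))"
  proof -
    have "\<exists>q :: complex \<Rightarrow> complex. continuous_on UNIV q \<and>
      (\<forall>z w. q z = q w \<longleftrightarrow> z = w \<or> (\<exists>e\<in>E. z \<in> path_image (M e) \<and> w \<in> path_image (M e)))"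
      by (intro disjoint_arcs_collapse finite_E arc_M M_disjoint)
    then show ?thesis using that by (elim exE conjE) simp
  qed
  \<comment> \<open>\<open>q\<close> is constant on the middle arc, so any of its points gives the
    same value.\<close>
  define F where "F e = q (pathstart (M e))" for e
  have F: "q z = F e \<longleftrightarrow> z \<in> path_image (M e)" if "e \<in> E" for z e
    using q(2)[of z "pathstart (M e)"] M_disjoint[OF that] that pathstart_in_path_image[of "M e"]
    unfolding F_def by blast
  define R where "R ee u v w \<longleftrightarrow> ee = {{u, v}, {u, w}} \<and> {u, v} \<in> E \<and> {u, w} \<in> E \<and> {v, w} \<in> E"
    for ee u v w
  have "\<exists>u v w. R ee u v w" if "ee \<in> TS_edges V E 2" for ee
    using TS_edges_2E[OF simple that] unfolding R_def by metis
  then obtain U A B where R: "\<And>ee. ee \<in> TS_edges V E 2 \<Longrightarrow> R ee (U ee) (A ee) (B ee)" by metis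
  define \<gamma> where "\<gamma> ee = q \<circ> linepath (p (U ee) {U ee, A ee}) (p (U ee) {U ee, B ee})" for ee
  have im: "path_image (\<gamma> ee) = q ` chord (U ee) (A ee) (B ee)" for ee
    by (simp add: \<gamma>_def path_image_compose chord_def)
  have hit: "e \<in> ee" if "ee \<in> TS_edges V E 2" "e \<in> E" "z \<in> chord (U ee) (A ee) (B ee)" "z \<in> path_image (M e)"
    for ee e z
    using R[OF that(1)] chord_Int_M[OF _ _ _ that(2-4)] edge_neq unfolding R_def by blast
  show ?thesis
    unfolding planar_def k_cliques_2[OF simple]
  proof (intro exI[of _ F] exI[of _ \<gamma>] conjI ballI impI)
    show "inj_on F E"
    proof (rule inj_onI)
      fix e e' assume e: "e \<in> E" "e' \<in> E" "F e = F e'"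
      then have "pathstart (M e) \<in> path_image (M e')" using F[OF e(2), of "pathstart (M e)"] by (simp add: F_def)
      then show "e = e'" using M_disjoint[OF e(1,2)] pathstart_in_path_image[of "M e"] by blast
    qed
  next
    fix ee assume ee: "ee \<in> TS_edges V E 2"
    define u v w where "u = U ee" and "v = A ee" and "w = B ee"
    have uvw: "ee = {{u, v}, {u, w}}" "{u, v} \<in> E" "{u, w} \<in> E" "{v, w} \<in> E"
      using R[OF ee] unfolding R_def u_def v_def w_def by blast+
    have vw: "v \<noteq> w" using uvw(4) edge_neq by blast
    have g: "\<gamma> ee = q \<circ> linepath (p u {u, v}) (p u {u, w})" by (simp add: \<gamma>_def u_def v_def w_def)
    have imq: "path_image (\<gamma> ee) = q ` chord u v w" using im by (simp add: u_def v_def w_def)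
    show "arc (\<gamma> ee)"
    proof -
      have "arc (linepath (p u {u, v}) (p u {u, w}))" using p_neq[OF uvw(2,3) vw] by simp
      moreover have "inj_on q (chord u v w)"
      proof (rule inj_onI)
        fix z z' assume z: "z \<in> chord u v w" "z' \<in> chord u v w" "q z = q z'"
        then consider "z = z'" | e where "e \<in> E" "z \<in> path_image (M e)" "z' \<in> path_image (M e)"
          using q(2) by blast
        then show "z = z'"
        proof cases
          case (2 e)
          then show ?thesis using chord_Int_M[OF uvw(2,3) vw 2(1)] z(1,2) by metis
        qed
      qed
      ultimately show ?thesis unfolding g chord_def
        by (metis UNIV_I arc_def comp_inj_on continuous_on_subset path_continuous_image path_image_def
            path_image_linepath q(1) subsetI)
    qed
    have ends: "q (p u {u, v}) = F {u, v}" "q (p u {u, w}) = F {u, w}"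
      using F p_in_M uvw by blast+
    then show "{pathstart (\<gamma> ee), pathfinish (\<gamma> ee)} = F ` ee"
      unfolding g by (simp add: pathstart_compose pathfinish_compose uvw(1))
    show "path_image (\<gamma> ee) \<inter> F ` E = F ` ee"
    proof
      show "path_image (\<gamma> ee) \<inter> F ` E \<subseteq> F ` ee"
      proof
        fix y assume "y \<in> path_image (\<gamma> ee) \<inter> F ` E"
        then obtain z e where ze: "z \<in> chord (U ee) (A ee) (B ee)" "e \<in> E" "y = F e" "q z = F e"
          unfolding im by auto
        then show "y \<in> F ` ee" using hit[OF ee ze(2,1)] F[OF ze(2)] by blast
      qed
      have "F {u, v} \<in> path_image (\<gamma> ee)" "F {u, w} \<in> path_image (\<gamma> ee)"
        unfolding imq ends[symmetric] by (auto simp: chord_def)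
      then show "F ` ee \<subseteq> path_image (\<gamma> ee) \<inter> F ` E" using uvw by auto
    qed
  next
    fix ee ee' assume ee: "ee \<in> TS_edges V E 2" "ee' \<in> TS_edges V E 2" "ee \<noteq> ee'"
    define u v w where "u = U ee" and "v = A ee" and "w = B ee"
    have uvw: "ee = {{u, v}, {u, w}}" "{u, v} \<in> E" "{u, w} \<in> E" "{v, w} \<in> E"
      using R[OF ee(1)] unfolding R_def u_def v_def w_def by blast+
    define u' x y where "u' = U ee'" and "x = A ee'" and "y = B ee'"
    have uxy: "ee' = {{u', x}, {u', y}}" "{u', x} \<in> E" "{u', y} \<in> E" "{x, y} \<in> E"
      using R[OF ee(2)] unfolding R_def u'_def x_def y_def by blast+
    show "path_image (\<gamma> ee) \<inter> path_image (\<gamma> ee') \<subseteq> F ` (ee \<inter> ee')"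
    proof
      fix a assume "a \<in> path_image (\<gamma> ee) \<inter> path_image (\<gamma> ee')"
      then obtain z z' where z: "a = q z" "z \<in> chord u v w" and z': "a = q z'" "z' \<in> chord u' x y"
        unfolding im u_def v_def w_def u'_def x_def y_def by blast
      \<comment> \<open>Equal images come from one middle arc or from equal points. In the latter
        case the chords lie in one disc and meet in a common end, which is again on a middle arc; so
        drawn edges meet only in vertices.\<close>
      have "\<exists>e\<in>E. z \<in> path_image (M e) \<and> z' \<in> path_image (M e)"
      proof (rule ccontr)
        assume no: "\<not> ?thesis"
        then have zz: "z = z'" using z(1) z'(1) q(2) by blast
        have "u = u'"
        proof (rule ccontr)
          assume "u \<noteq> u'"
          then have "cball (f u) r \<inter> cball (f u') r = {}"
            using uvw(2) uxy(2) edge_in_V by (intro discs) blast+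
          then show False
            using chord_cball[OF uvw(2,3)] chord_cball[OF uxy(2,3)] z(2) z'(2) zz by blast
        qed
        moreover have "{v, w} \<noteq> {x, y}"
          using ee(3) uvw(1) uxy(1) \<open>u = u'\<close> by (auto simp: doubleton_eq_iff)
        ultimately obtain t where "t \<in> {v, w}" "z = p u {u, t}"
          using chords_meet[OF uvw(2-4), of x y z] uxy z(2) z'(2) zz by blast
        then have "z \<in> path_image (M {u, t})" "{u, t} \<in> E"
          using p_in_M[of "{u, t}" u] uvw by auto
        then show False using no zz by blast
      qed
      then obtain e where e: "e \<in> E" "z \<in> path_image (M e)" "z' \<in> path_image (M e)" by blast
      have "e \<in> ee" using hit[OF ee(1) e(1) _ e(2)] z(2) by (simp add: u_def v_def w_def)
      moreover have "e \<in> ee'" using hit[OF ee(2) e(1) _ e(3)] z'(2) by (simp add: u'_def x_def y_def)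
      moreover have "a = F e" using F[OF e(1)] e(2) z(1) by blast
      ultimately show "a \<in> F ` (ee \<inter> ee')" by blast
    qed
  qed
qed

end

section \<open>Straight-line drawings of forests of 4-cliques\<close>

text \<open>Convex hulls stand for segments, so that no order of the ends of an edge has to be
  chosen. All of \<open>V\<close> is placed from the start, also the vertices that no edge has
  reached yet.\<close>

definition straight_drawing :: "('a \<Rightarrow> complex) \<Rightarrow> 'a set \<Rightarrow> 'a set set \<Rightarrow> bool" where
  "straight_drawing f V E \<longleftrightarrow> inj_on f V \<and>
    (\<forall>e\<in>E. convex hull (f ` e) \<inter> f ` V \<subseteq> f ` e) \<and>
    (\<forall>e\<in>E. \<forall>e'\<in>E. e \<noteq> e' \<longrightarrow> convex hull (f ` e) \<inter> convex hull (f ` e') \<subseteq> f ` (e \<inter> e'))"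

lemma straight_drawing_subset:
  "straight_drawing f V E \<Longrightarrow> E' \<subseteq> E \<Longrightarrow> straight_drawing f V E'"
  unfolding straight_drawing_def by (meson subsetD)

lemma straight_drawing_imp_planar:
  fixes V :: "'a set"
  assumes f: "straight_drawing f V E" and E: "\<And>e. e \<in> E \<Longrightarrow> \<exists>u v. u \<in> V \<and> v \<in> V \<and> u \<noteq> v \<and> e = {u, v}"
  shows "planar V E"
proof -
  have "\<exists>u v. u \<in> V \<and> v \<in> V \<and> u \<noteq> v \<and> e = {u, v}" if "e \<in> E" for e using E[OF that] .
  then obtain a b where ab: "\<And>e. e \<in> E \<Longrightarrow> a e \<in> V \<and> b e \<in> V \<and> a e \<noteq> b e \<and> e = {a e, b e}"
    by metis
  define \<gamma> where "\<gamma> e = linepath (f (a e)) (f (b e))" for e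
  have inj: "inj_on f V" and on_edge: "\<And>e. e \<in> E \<Longrightarrow> convex hull (f ` e) \<inter> f ` V \<subseteq> f ` e"
    and cross: "\<And>e e'. e \<in> E \<Longrightarrow> e' \<in> E \<Longrightarrow> e \<noteq> e' \<Longrightarrow>
      convex hull (f ` e) \<inter> convex hull (f ` e') \<subseteq> f ` (e \<inter> e')"
    using f by (simp_all add: straight_drawing_def)
  have fe: "f ` e = {f (a e), f (b e)}" if "e \<in> E" for e using ab[OF that] by (metis image_empty image_insert)
  have im: "path_image (\<gamma> e) = convex hull (f ` e)" if "e \<in> E" for e
    unfolding fe[OF that] by (simp add: \<gamma>_def segment_convex_hull)
  show ?thesis unfolding planar_def
  proof (intro exI[of _ f] exI[of _ \<gamma>] conjI ballI impI)
    show "inj_on f V" by (fact inj)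
    fix e assume e: "e \<in> E"
    have "f (a e) \<noteq> f (b e)" using ab[OF e] inj by (metis inj_onD)
    then show "arc (\<gamma> e)" by (simp add: \<gamma>_def)
    show "{pathstart (\<gamma> e), pathfinish (\<gamma> e)} = f ` e" by (simp add: \<gamma>_def fe[OF e])
    have "f ` e \<subseteq> f ` V" unfolding fe[OF e] using ab[OF e] by simp
    then show "path_image (\<gamma> e) \<inter> f ` V = f ` e"
      using on_edge[OF e] hull_subset[of "f ` e" convex] unfolding im[OF e] by blast
    fix e' assume e': "e' \<in> E" "e \<noteq> e'"
    then show "path_image (\<gamma> e) \<inter> path_image (\<gamma> e') \<subseteq> f ` (e \<inter> e')"
      using cross e im by simp
  qed
qed

text \<open>A triangle at \<open>T\<close> inside a cone that avoids the finitely many directions in which segments leave \<open>T\<close>.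
  Points are allowed among the segments, as pairs \<open>(c, c)\<close>.\<close>

lemma thin_triangle:
  fixes T :: complex
  assumes "finite C" and C: "\<And>c d. (c, d) \<in> C \<Longrightarrow> T \<in> closed_segment c d \<Longrightarrow> c = T"
  obtains X Y where "orient T X Y > 0"
    "\<And>c d. (c, d) \<in> C \<Longrightarrow> convex hull {T, X, Y} \<inter> closed_segment c d \<subseteq> {T}"
proof -
  have "\<exists>\<rho>>0. \<forall>x\<in>C. T \<notin> closed_segment (fst x) (snd x) \<longrightarrow> ball T \<rho> \<inter> closed_segment (fst x) (snd x) = {}"
  proof -
    let ?W = "\<Union>x\<in>{x \<in> C. T \<notin> closed_segment (fst x) (snd x)}. closed_segment (fst x) (snd x)"
    have "closed ?W" using assms(1) by (intro closed_UN) auto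
    then have "open (- ?W)" by (rule open_Compl)
    moreover have "T \<in> - ?W" by blast
    ultimately obtain \<rho> where "\<rho> > 0" "ball T \<rho> \<subseteq> - ?W" by (meson open_contains_ball)
    then show ?thesis by blast
  qed
  then obtain \<rho> where \<rho>: "\<rho> > 0"
    "\<And>c d. (c, d) \<in> C \<Longrightarrow> T \<notin> closed_segment c d \<Longrightarrow> ball T \<rho> \<inter> closed_segment c d = {}"
    by fastforce
  \<comment> \<open>Division by zero gives vertical directions the slope \<open>0\<close>; this is
    harmless, since slopes are compared only where the real part is positive.\<close>
  define slope where "slope x = Im (snd x - T) / Re (snd x - T)" for x :: "complex \<times> complex"
  obtain N where N: "\<And>x. x \<in> C \<Longrightarrow> slope x < N"
  proof -
    have "finite (insert 0 (slope ` C))" using assms(1) by simp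
    then have "slope x \<le> Max (insert 0 (slope ` C))" if "x \<in> C" for x
      using that by (intro Max_ge) auto
    then have "slope x < Max (insert 0 (slope ` C)) + 1" if "x \<in> C" for x
      using that by fastforce
    then show ?thesis using that by blast
  qed
  \<comment> \<open>The scale \<open>s\<close> has to make both sides at \<open>T\<close> shorter
    than \<open>\<rho>\<close>. The sum of the two lengths bounds each of them, and the summand
    \<open>1\<close> makes \<open>K\<close> positive.\<close>
  define K where "K = norm (Complex 1 N) + norm (Complex 1 (N + 1)) + 1"
  have K: "K > 0" by (simp add: K_def add_nonneg_pos)
  define s where "s = \<rho> / (2 * K)"
  have s: "s > 0" using \<rho>(1) K by (simp add: s_def)
  define X where "X = T + s *\<^sub>R Complex 1 N"
  define Y where "Y = T + s *\<^sub>R Complex 1 (N + 1)"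
  have "s * K = \<rho> / 2" using K by (simp add: s_def)
  then have sum: "s * norm (Complex 1 N) + s * norm (Complex 1 (N + 1)) + s = \<rho> / 2"
    by (simp add: K_def algebra_simps)
  have nn: "0 \<le> s * norm (Complex 1 N)" "0 \<le> s * norm (Complex 1 (N + 1))" using s by simp_all
  then have "s * norm (Complex 1 N) < \<rho>" "s * norm (Complex 1 (N + 1)) < \<rho>"
    using sum s \<rho>(1) by linarith+
  then have "{T, X, Y} \<subseteq> ball T \<rho>"
    using s \<rho>(1) by (simp add: X_def Y_def dist_norm)
  then have hb: "convex hull {T, X, Y} \<subseteq> ball T \<rho>" by (simp add: hull_minimal)
  have "orient T X Y = s * s" by (simp add: orient_def X_def Y_def algebra_simps)
  then have "orient T X Y > 0" using s by simp
  moreover have "convex hull {T, X, Y} \<inter> closed_segment c d \<subseteq> {T}" if cd: "(c, d) \<in> C" for c d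
  proof (cases "T \<in> closed_segment c d")
    case False
    then show ?thesis using \<rho>(2)[OF cd] hb by blast
  next
    case True
    then have c: "c = T" using C cd by blast
    show ?thesis
    proof (clarify, rule ccontr)
      fix z assume z: "z \<in> convex hull {T, X, Y}" "z \<in> closed_segment c d" "z \<noteq> T"
      obtain a0 a b where ab: "0 \<le> a" "0 \<le> b" "a0 + a + b = 1" "z = a0 *\<^sub>R T + a *\<^sub>R X + b *\<^sub>R Y"
        using z(1) unfolding convex_hull_3 by blast
      have a0: "a0 = 1 - a - b" using ab(3) by simp
      then have zT: "z - T = (s * a) *\<^sub>R Complex 1 N + (s * b) *\<^sub>R Complex 1 (N + 1)"
        unfolding ab(4) X_def Y_def a0 by (simp add: algebra_simps)
      have "a \<noteq> 0 \<or> b \<noteq> 0" using zT z(3) by auto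
      then have "a + b > 0" using ab(1,2) by linarith
      then have Re: "Re (z - T) > 0" using s unfolding zT by (simp flip: distrib_left)
      \<comment> \<open>The triangle lies to the right of \<open>T\<close> in the cone of slopes
        from \<open>N\<close> to \<open>N + 1\<close>, whereas a segment that leaves
        \<open>T\<close> to the right has a slope below \<open>N\<close>.\<close>
      have Im: "Im (z - T) = N * Re (z - T) + s * b" unfolding zT by (simp add: algebra_simps)
      obtain t where t: "0 \<le> t" "z = (1 - t) *\<^sub>R T + t *\<^sub>R d" using z(2) c unfolding in_segment by blast
      have zt: "z - T = t *\<^sub>R (d - T)" unfolding t(2) by (simp add: algebra_simps)
      have "t > 0" using zt z(3) t(1) by (cases "t = 0") auto
      then have Rd: "Re (d - T) > 0" using Re unfolding zt by (simp add: zero_less_mult_iff)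
      have "Im (d - T) < N * Re (d - T)" using N[OF cd] Rd by (simp add: slope_def field_simps)
      then have "t * Im (d - T) < t * (N * Re (d - T))" using \<open>t > 0\<close> by simp
      then have "Im (z - T) < N * Re (z - T)" unfolding zt by (simp add: algebra_simps)
      moreover have "0 \<le> s * b" using s ab(2) by simp
      ultimately show False using Im by linarith
    qed
  qed
  ultimately show ?thesis using that by blast
qed

text \<open>The centroid cuts the triangle into three triangles of a third of its area, so none of
  the four triples of points is degenerate.\<close>

lemma K4_orient_nonzero:
  assumes d: "orient T X Y > 0" and Z: "Z = (T + X + Y) / 3"
    and "a \<in> {T, X, Y, Z}" "b \<in> {T, X, Y, Z}" "c \<in> {T, X, Y, Z}" "a \<noteq> b" "a \<noteq> c" "b \<noteq> c"
  shows "orient a b c \<noteq> 0"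
proof -
  have "orient X Y Z = orient T X Y / 3" "orient T X Z = orient T X Y / 3" "orient T Y Z = - orient T X Y / 3"
    unfolding Z orient_def by (simp_all add: field_simps)
  then have nz: "orient T X Y \<noteq> 0" "orient X Y Z \<noteq> 0" "orient T X Z \<noteq> 0" "orient T Y Z \<noteq> 0" using d by auto
  have perm: "orient x y z \<noteq> 0 \<Longrightarrow> orient y x z \<noteq> 0 \<and> orient x z y \<noteq> 0 \<and> orient y z x \<noteq> 0 \<and> orient z x y \<noteq> 0 \<and> orient z y x \<noteq> 0"
    for x y z
    by (metis neg_equal_0_iff_equal orient_rotate orient_swap)
  from assms(3-8) show ?thesis
    using perm[OF nz(1)] perm[OF nz(2)] perm[OF nz(3)] perm[OF nz(4)] nz
    by (elim insertE emptyE) (simp_all only: simp_thms)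
qed

text \<open>Segments with a common end are handled by non-collinearity. In each of the three pairs
  without one, both ends of one segment lie strictly on the same side of the line through the
  other.\<close>

lemma K4_segments:
  assumes d: "orient T X Y > 0" and Z: "Z = (T + X + Y) / 3"
    and mem: "a \<in> {T, X, Y, Z}" "b \<in> {T, X, Y, Z}" "c \<in> {T, X, Y, Z}" "e \<in> {T, X, Y, Z}"
    and ne: "a \<noteq> b" "c \<noteq> e" "{a, b} \<noteq> {c, e}"
  shows "closed_segment a b \<inter> closed_segment c e \<subseteq> {a, b} \<inter> {c, e}"
proof -
  note nz = K4_orient_nonzero[OF d Z]
  have com: "closed_segment x y \<inter> closed_segment x z \<subseteq> {x}"
    if "x \<in> {T, X, Y, Z}" "y \<in> {T, X, Y, Z}" "z \<in> {T, X, Y, Z}" "x \<noteq> y" "x \<noteq> z" "y \<noteq> z" for x y z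
    using segments_common_end nz[OF that] by blast
  have D: "orient X Y Z = orient T X Y / 3" "orient T X Z = orient T X Y / 3" "orient T Y Z = - orient T X Y / 3"
    "orient T Y X = - orient T X Y" "orient X Y T = orient T X Y"
    unfolding Z orient_def by (simp_all add: field_simps)
  have cr: "closed_segment x y \<inter> closed_segment z w = {}" if "orient x y z * orient x y w > 0" for x y z w
    using crossing_segments_orient[of x y z w] that by force
  have X1: "closed_segment T X \<inter> closed_segment Y Z = {}" by (rule cr) (use D d in simp)
  have X2: "closed_segment T Y \<inter> closed_segment X Z = {}" by (rule cr) (use D d in simp)
  have X3: "closed_segment X Y \<inter> closed_segment T Z = {}" by (rule cr) (use D d in simp)
  consider "a = c" | "a = e" | "b = c" | "b = e" | "a \<noteq> c" "a \<noteq> e" "b \<noteq> c" "b \<noteq> e" by blast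
  then show ?thesis
  proof cases
    case 1
    have "closed_segment a b \<inter> closed_segment a e \<subseteq> {a}"
      by (rule com) (fact mem | use ne 1 in blast)+
    then show ?thesis using 1 by blast
  next
    case 2
    have "closed_segment a b \<inter> closed_segment a c \<subseteq> {a}"
      by (rule com) (fact mem | use ne 2 in blast)+
    then have "closed_segment a b \<inter> closed_segment c a \<subseteq> {a}" by (simp only: closed_segment_commute[of c])
    then show ?thesis using 2 by blast
  next
    case 3
    have "closed_segment b a \<inter> closed_segment b e \<subseteq> {b}"
      by (rule com) (fact mem | use ne 3 in blast)+
    then have "closed_segment a b \<inter> closed_segment b e \<subseteq> {b}" by (simp only: closed_segment_commute[of a])
    then show ?thesis using 3 by blast
  next
    case 4
    have "closed_segment b a \<inter> closed_segment b c \<subseteq> {b}"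
      by (rule com) (fact mem | use ne 4 in blast)+
    then have "closed_segment a b \<inter> closed_segment c b \<subseteq> {b}" by (simp only: closed_segment_commute[of _ b])
    then show ?thesis using 4 by blast
  next
    case 5
    have "closed_segment a b \<inter> closed_segment c e = {}"
      using mem ne(1,2) 5 X1 X2 X3
      by (elim insertE emptyE) (simp_all add: closed_segment_commute Int_commute)
    then show ?thesis by blast
  qed
qed

section \<open>Attaching copies of K4 to a straight drawing\<close>

definition pairs :: "'a set \<Rightarrow> 'a set set" where
  "pairs Q = {e. e \<subseteq> Q \<and> card e = 2}"

lemma pairsE:
  assumes "e \<in> pairs Q"
  obtains a b where "a \<in> Q" "b \<in> Q" "a \<noteq> b" "e = {a, b}"
  using assms by (auto simp: pairs_def card_2_iff)

text \<open>No edge of \<open>E\<close> uses \<open>x\<close>, \<open>y\<close>, \<open>z\<close>,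
  so these vertices can be moved without disturbing the drawing: to the two other corners and the
  centroid of a thin triangle at \<open>f t\<close>. All else meets this triangle at most in
  \<open>f t\<close>, so the new segments have to be compared in earnest only with each
  other.\<close>

lemma straight_drawing_add_K4:
  assumes f: "straight_drawing f V E" and fin: "finite V" "finite E"
    and E: "\<And>e. e \<in> E \<Longrightarrow> \<exists>u v. u \<in> V \<and> v \<in> V \<and> u \<noteq> v \<and> e = {u, v}"
    and V: "t \<in> V" "x \<in> V" "y \<in> V" "z \<in> V"
    and dist: "t \<noteq> x" "t \<noteq> y" "t \<noteq> z" "x \<noteq> y" "x \<noteq> z" "y \<noteq> z"
    and iso: "\<And>e. e \<in> E \<Longrightarrow> x \<notin> e \<and> y \<notin> e \<and> z \<notin> e"
  shows "\<exists>f'. straight_drawing f' V (E \<union> pairs {t, x, y, z})"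
proof -
  have inj: "inj_on f V" and on_edge: "\<And>e. e \<in> E \<Longrightarrow> convex hull (f ` e) \<inter> f ` V \<subseteq> f ` e"
    and cross: "\<And>e e'. e \<in> E \<Longrightarrow> e' \<in> E \<Longrightarrow> e \<noteq> e' \<Longrightarrow>
      convex hull (f ` e) \<inter> convex hull (f ` e') \<subseteq> f ` (e \<inter> e')"
    using f by (simp_all add: straight_drawing_def)
  define T where "T = f t"
  \<comment> \<open>The obstacles are the vertices other than \<open>t\<close>, as degenerate
    segments, and the edges. By \<open>v \<noteq> t\<close> an edge at \<open>t\<close> enters only
    with \<open>t\<close> as its first end, as \<open>thin_triangle\<close> requires.\<close>
  define C where "C = (\<lambda>v. (f v, f v)) ` (V - {t}) \<union> {(f u, f v) |u v. {u, v} \<in> E \<and> v \<noteq> t}"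
  have "finite C"
  proof -
    have "C \<subseteq> f ` V \<times> f ` V" using E unfolding C_def by (fastforce simp: doubleton_eq_iff)
    then show ?thesis using fin finite_subset by blast
  qed
  have at_t: "t \<in> e" if "e \<in> E" "T \<in> convex hull (f ` e)" for e
  proof -
    have "T \<in> f ` e" using on_edge[OF that(1)] that(2) V(1) by (auto simp: T_def)
    moreover have "e \<subseteq> V" using E[OF that(1)] by auto
    ultimately show ?thesis using inj V(1) unfolding T_def by (metis imageE inj_onD subsetD)
  qed
  have "c = T" if cd: "(c, d) \<in> C" "T \<in> closed_segment c d" for c d
  proof -
    from cd(1) consider v where "v \<in> V" "v \<noteq> t" "c = f v" "d = f v"
      | u v where "c = f u" "d = f v" "{u, v} \<in> E" "v \<noteq> t"
      unfolding C_def by auto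
    then show ?thesis
    proof cases
      case 1
      then show ?thesis using cd(2) by simp
    next
      case (2 u v)
      then have "t \<in> {u, v}" using at_t[of "{u, v}"] cd(2) by (simp add: segment_convex_hull)
      then show ?thesis using 2 by (auto simp: T_def)
    qed
  qed
  then obtain X Y where XY: "orient T X Y > 0"
    "\<And>c d. (c, d) \<in> C \<Longrightarrow> convex hull {T, X, Y} \<inter> closed_segment c d \<subseteq> {T}"
    using thin_triangle[OF \<open>finite C\<close>, of T] by metis
  define Z where "Z = (T + X + Y) / 3"
  let ?D = "convex hull {T, X, Y}"
  have Dv: "f v \<notin> ?D" if "v \<in> V" "v \<noteq> t" for v
  proof
    assume "f v \<in> ?D"
    moreover have "(f v, f v) \<in> C" using that by (auto simp: C_def)
    ultimately have "f v = T" using XY(2)[of "f v" "f v"] by auto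
    then show False using inj that V(1) by (auto simp: T_def inj_on_def)
  qed
  have De: "?D \<inter> convex hull (f ` e) \<subseteq> {T}" if e: "e \<in> E" for e
  proof -
    obtain u v where uv: "u \<noteq> v" "e = {u, v}" using E[OF e] by blast
    then consider "{u, v} \<in> E" "v \<noteq> t" | "{v, u} \<in> E" "u \<noteq> t" using e by (metis insert_commute)
    then have "(f u, f v) \<in> C \<or> (f v, f u) \<in> C" by cases (auto simp: C_def)
    then have "?D \<inter> closed_segment (f u) (f v) \<subseteq> {T}"
      using XY(2)[of "f u" "f v"] XY(2)[of "f v" "f u"] by (auto simp: closed_segment_commute)
    then show ?thesis using uv(2) by (simp add: segment_convex_hull)
  qed
  let ?P = "{T, X, Y, Z}"
  have "Z = (1/3) *\<^sub>R T + (1/3) *\<^sub>R X + (1/3) *\<^sub>R Y"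
    by (simp add: Z_def scaleR_conv_of_real field_simps)
  then have ZD: "Z \<in> ?D" unfolding convex_hull_3 by force
  have PD: "?P \<subseteq> ?D" using ZD hull_subset[of "{T, X, Y}" convex] by auto
  have XYne: "T \<noteq> X" "T \<noteq> Y" "X \<noteq> Y" using XY(1) by auto
  have oZ: "orient T X Z = orient T X Y / 3" "orient T Y Z = - orient T X Y / 3" "orient X Y Z = orient T X Y / 3"
    unfolding Z_def orient_def by (simp_all add: field_simps)
  then have Zne: "Z \<noteq> T" "Z \<noteq> X" "Z \<noteq> Y" using XY(1) by auto
  define f' where "f' = f(x := X, y := Y, z := Z)"
  have f'Q: "f' t = T" "f' x = X" "f' y = Y" "f' z = Z" using dist by (auto simp: f'_def T_def)
  have f'o: "f' v = f v" if "v \<notin> {x, y, z}" for v using that by (simp add: f'_def)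
  let ?Q = "{t, x, y, z}"
  have f'P: "f' v \<in> ?P" if "v \<in> ?Q" for v using that f'Q by auto
  have f'D: "f' v \<notin> ?D" if "v \<in> V" "v \<notin> ?Q" for v using that Dv f'o by auto
  have injQ: "inj_on f' ?Q" using f'Q XYne Zne by (auto simp: inj_on_def)
  have inj': "inj_on f' V"
  proof (rule inj_onI)
    fix u v assume uv: "u \<in> V" "v \<in> V" "f' u = f' v"
    consider "u \<in> ?Q" "v \<in> ?Q" | "u \<in> ?Q" "v \<notin> ?Q" | "u \<notin> ?Q" "v \<in> ?Q" | "u \<notin> ?Q" "v \<notin> ?Q" by blast
    then show "u = v"
    proof cases
      case 1
      then show ?thesis using injQ uv(3) by (meson inj_onD)
    next
      case 2
      then show ?thesis using f'P[of u] PD f'D[OF uv(2)] uv(3) by (metis subsetD)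
    next
      case 3
      then show ?thesis using f'P[of v] PD f'D[OF uv(1)] uv(3) by (metis subsetD)
    next
      case 4
      then have "f u = f v" using uv(3) f'o[of u] f'o[of v] by simp
      then show ?thesis using inj uv by (metis inj_onD)
    qed
  qed
  have f'e: "f' ` e = f ` e" if "e \<in> E" for e
    using iso[OF that] by (intro image_cong refl f'o) auto
  have seg: "convex hull (f' ` {a, b}) = closed_segment (f' a) (f' b)" for a b
    by (simp add: segment_convex_hull)
  have segD: "closed_segment (f' a) (f' b) \<subseteq> ?D" if "a \<in> ?Q" "b \<in> ?Q" for a b
    using f'P[OF that(1)] f'P[OF that(2)] PD by (intro closed_segment_subset) auto
  have vertex_on_new: "f' v \<in> f' ` {a, b}"
    if ab: "a \<in> ?Q" "b \<in> ?Q" "a \<noteq> b" and v: "v \<in> V" "f' v \<in> closed_segment (f' a) (f' b)" for a b v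
  proof (rule ccontr)
    assume no: "f' v \<notin> f' ` {a, b}"
    have vQ: "v \<in> ?Q" using f'D[OF v(1)] segD[OF ab(1,2)] v(2) by blast
    have "f' a \<noteq> f' b" using injQ ab by (meson inj_onD)
    then have "orient (f' a) (f' b) (f' v) \<noteq> 0"
      using no by (intro K4_orient_nonzero[OF XY(1) Z_def] f'P ab vQ) auto
    then show False using orient_segment v(2) by blast
  qed
  have "straight_drawing f' V (E \<union> pairs ?Q)"
    unfolding straight_drawing_def
  proof (intro conjI ballI impI)
    show "inj_on f' V" by (fact inj')
  next
    fix e assume "e \<in> E \<union> pairs ?Q"
    then show "convex hull (f' ` e) \<inter> f' ` V \<subseteq> f' ` e"
    proof
      assume e: "e \<in> E"
      show ?thesis
      proof
        fix w assume w: "w \<in> convex hull (f' ` e) \<inter> f' ` V"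
        then obtain v where v: "v \<in> V" "w = f' v" by blast
        have wc: "w \<in> convex hull (f ` e)" using w f'e[OF e] by simp
        show "w \<in> f' ` e"
        proof (cases "v \<in> ?Q")
          case True
          then have "w \<in> ?D" using f'P PD v(2) by blast
          then have "w = T" using De[OF e] wc by blast
          then have "t \<in> e" using at_t[OF e] wc by simp
          then show ?thesis using \<open>w = T\<close> f'Q(1) by (metis imageI)
        next
          case False
          then have "w \<in> f ` V" using v f'o by auto
          then show ?thesis using on_edge[OF e] wc f'e[OF e] by blast
        qed
      qed
    next
      assume "e \<in> pairs ?Q"
      then obtain a b where ab: "a \<in> ?Q" "b \<in> ?Q" "a \<noteq> b" "e = {a, b}" by (rule pairsE)
      show ?thesis using vertex_on_new[OF ab(1-3)] unfolding ab(4) seg by blast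
    qed
  next
    fix e e' assume ee: "e \<in> E \<union> pairs ?Q" "e' \<in> E \<union> pairs ?Q" "e \<noteq> e'"
    \<comment> \<open>An old and a new edge can meet only in \<open>T\<close>, and each of them
      passes through \<open>T\<close> only if \<open>t\<close> is one of its ends.\<close>
    have mixed: "convex hull (f' ` e) \<inter> convex hull (f' ` e') \<subseteq> f' ` (e \<inter> e')" if e: "e \<in> E" "e' \<in> pairs ?Q" for e e'
    proof
      fix w assume w: "w \<in> convex hull (f' ` e) \<inter> convex hull (f' ` e')"
      obtain a b where ab: "a \<in> ?Q" "b \<in> ?Q" "a \<noteq> b" "e' = {a, b}" using e(2) by (rule pairsE)
      have "w \<in> ?D" using w segD[OF ab(1,2)] unfolding ab(4) seg by blast
      moreover have wc: "w \<in> convex hull (f ` e)" using w f'e[OF e(1)] by simp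
      ultimately have "w = T" using De[OF e(1)] by blast
      then have "t \<in> e" using at_t[OF e(1)] wc by simp
      have "f' t \<in> f' ` {a, b}"
        using vertex_on_new[OF ab(1-3) V(1)] w \<open>w = T\<close> f'Q(1) unfolding ab(4) seg by simp
      then have "t \<in> {a, b}" using injQ ab(1,2) by (auto dest: inj_onD)
      then show "w \<in> f' ` (e \<inter> e')" using \<open>t \<in> e\<close> \<open>w = T\<close> f'Q(1) ab(4) by blast
    qed
    from ee(1,2) consider "e \<in> E" "e' \<in> E" | "e \<in> E" "e' \<in> pairs ?Q" | "e' \<in> E" "e \<in> pairs ?Q"
      | "e \<in> pairs ?Q" "e' \<in> pairs ?Q" by blast
    then show "convex hull (f' ` e) \<inter> convex hull (f' ` e') \<subseteq> f' ` (e \<inter> e')"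
    proof cases
      case 1
      have "f' ` (e \<inter> e') = f ` (e \<inter> e')" using iso[OF 1(1)] by (intro image_cong refl f'o) auto
      then show ?thesis using cross[OF 1 ee(3)] f'e 1 by simp
    next
      case 2
      then show ?thesis by (rule mixed)
    next
      case 3
      then show ?thesis using mixed[of e' e] by (simp add: Int_commute)
    next
      case 4
      obtain a b where ab: "a \<in> ?Q" "b \<in> ?Q" "a \<noteq> b" "e = {a, b}" using 4(1) by (rule pairsE)
      obtain c d where cd: "c \<in> ?Q" "d \<in> ?Q" "c \<noteq> d" "e' = {c, d}" using 4(2) by (rule pairsE)
      have sub: "{a, b} \<subseteq> ?Q" "{c, d} \<subseteq> ?Q" using ab cd by auto
      have "f' ` {a, b} \<noteq> f' ` {c, d}"
        using inj_on_image_eq_iff[OF injQ sub] ee(3) ab(4) cd(4) by simp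
      moreover have "f' a \<noteq> f' b" "f' c \<noteq> f' d" using injQ ab cd by (meson inj_onD)+
      ultimately have "closed_segment (f' a) (f' b) \<inter> closed_segment (f' c) (f' d) \<subseteq> f' ` {a, b} \<inter> f' ` {c, d}"
        using K4_segments[OF XY(1) Z_def f'P[OF ab(1)] f'P[OF ab(2)] f'P[OF cd(1)] f'P[OF cd(2)]] by simp
      also have "\<dots> = f' ` ({a, b} \<inter> {c, d})" using inj_on_image_Int[OF injQ sub] by simp
      finally show ?thesis unfolding ab(4) cd(4) seg .
    qed
  qed
  then show ?thesis by blast
qed

text \<open>Induction on the number of sets: a member that meets the others in at most one vertex is
  set aside, the rest is drawn, and the member is attached there. The condition speaks of all
  nonempty subfamilies so that it passes on to the rest.\<close>

lemma straight_drawing_K4_forest: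
  fixes V :: "'a set"
  assumes V: "finite V" and "finite \<Q>"
    and "\<And>Q. Q \<in> \<Q> \<Longrightarrow> Q \<subseteq> V \<and> card Q = 4"
    and "\<And>\<R>. \<R> \<subseteq> \<Q> \<Longrightarrow> \<R> \<noteq> {} \<Longrightarrow> \<exists>Q\<in>\<R>. \<exists>t. \<forall>Q'\<in>\<R> - {Q}. Q \<inter> Q' \<subseteq> {t}"
  shows "\<exists>f. straight_drawing f V (\<Union>Q\<in>\<Q>. pairs Q)"
  using assms(2-4)
proof (induction "card \<Q>" arbitrary: \<Q>)
  case 0
  \<comment> \<open>Without edges any distinct positions will do; here they are natural numbers on
    the real line.\<close>
  obtain g :: "'a \<Rightarrow> nat" where g: "inj_on g V" using V finite_imp_inj_to_nat_seg by metis
  have "inj_on (\<lambda>v. of_nat (g v) :: complex) V" using g by (auto simp: inj_on_def)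
  then have "straight_drawing (\<lambda>v. of_nat (g v)) V {}" by (simp add: straight_drawing_def)
  then show ?case using 0 by auto
next
  case (Suc n)
  then have "\<Q> \<noteq> {}" by auto
  then obtain Q t0 where Q: "Q \<in> \<Q>" "\<And>Q'. Q' \<in> \<Q> - {Q} \<Longrightarrow> Q \<inter> Q' \<subseteq> {t0}"
  proof -
    have "\<exists>Q\<in>\<Q>. \<exists>t. \<forall>Q'\<in>\<Q> - {Q}. Q \<inter> Q' \<subseteq> {t}"
      by (rule Suc.prems(3)) (use \<open>\<Q> \<noteq> {}\<close> in auto)
    then show ?thesis using that by (elim bexE exE) (rule that, auto)
  qed
  let ?\<R> = "\<Q> - {Q}"
  let ?E = "\<Union>Q\<in>?\<R>. pairs Q"
  have QV: "Q \<subseteq> V" "card Q = 4" using Suc.prems(2)[OF Q(1)] by auto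
  have "\<exists>f. straight_drawing f V ?E"
  proof (rule Suc.hyps(1))
    show "n = card ?\<R>" using Suc.hyps(2) Suc.prems(1) Q(1) by simp
    show "\<exists>Q\<in>\<S>. \<exists>t. \<forall>Q'\<in>\<S> - {Q}. Q \<inter> Q' \<subseteq> {t}" if "\<S> \<subseteq> ?\<R>" "\<S> \<noteq> {}" for \<S>
      by (rule Suc.prems(3)) (use that in auto)
  qed (use Suc.prems in auto)
  then obtain f where f: "straight_drawing f V ?E" by blast
  \<comment> \<open>The attaching vertex can be taken in \<open>Q\<close>: if \<open>t0\<close> is
    not, then \<open>Q\<close> is disjoint from the other members and any of its elements
    serves.\<close>
  obtain t where t: "t \<in> Q" "\<And>Q'. Q' \<in> ?\<R> \<Longrightarrow> Q \<inter> Q' \<subseteq> {t}"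
  proof (cases "t0 \<in> Q")
    case True
    then show ?thesis using that Q(2) by blast
  next
    case False
    obtain t1 where "t1 \<in> Q" using QV(2) by fastforce
    then show ?thesis using that[of t1] Q(2) False by blast
  qed
  have "finite Q" using QV(2) by (metis card.infinite zero_neq_numeral)
  then have "card (Q - {t}) = 3" using t(1) QV(2) by simp
  then obtain x y z where xyz: "Q - {t} = {x, y, z}" "x \<noteq> y" "y \<noteq> z" "x \<noteq> z"
    by (metis card_3_iff)
  then have Qe: "Q = {t, x, y, z}" "t \<notin> {x, y, z}" using t(1) by auto
  have "\<exists>f'. straight_drawing f' V (?E \<union> pairs {t, x, y, z})"
  proof (rule straight_drawing_add_K4[OF f V])
    have "?E \<subseteq> Pow V" using Suc.prems(2) by (fastforce simp: pairs_def)
    then show "finite ?E" using V finite_subset by blast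
    show "\<exists>u v. u \<in> V \<and> v \<in> V \<and> u \<noteq> v \<and> e = {u, v}" if e: "e \<in> ?E" for e
    proof -
      obtain Q' where "Q' \<in> \<Q>" "e \<in> pairs Q'" using e by blast
      then show ?thesis using Suc.prems(2)[of Q'] by (elim pairsE) blast
    qed
    show "x \<notin> e \<and> y \<notin> e \<and> z \<notin> e" if e: "e \<in> ?E" for e
    proof -
      obtain Q' where Q': "Q' \<in> ?\<R>" "e \<subseteq> Q'" using e by (auto simp: pairs_def)
      have "Q \<inter> Q' \<subseteq> {t}" using t(2)[OF Q'(1)] .
      then show ?thesis using Q'(2) Qe by blast
    qed
  qed (use QV(1) Qe xyz in auto)
  moreover have "?E \<union> pairs {t, x, y, z} = (\<Union>Q\<in>\<Q>. pairs Q)" using Q(1) Qe(1) by blast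
  ultimately show ?case by simp
qed

section \<open>The 4-cliques of a plane graph\<close>

text \<open>The component is the inside or the outside, and by the Jordan curve theorem each of
  these has the whole curve as its frontier.\<close>

lemma frontier_Jordan_component:
  fixes c :: "real \<Rightarrow> complex"
  assumes "simple_path c" "pathfinish c = pathstart c" "z \<notin> path_image c"
  shows "frontier (connected_component_set (- path_image c) z) = path_image c"
proof -
  let ?P = "path_image c"
  have J: "connected (inside ?P)" "connected (outside ?P)" "inside ?P \<union> outside ?P = - ?P"
    "frontier (inside ?P) = ?P" "frontier (outside ?P) = ?P"
    using Jordan_inside_outside[OF assms(1,2)] by auto
  consider "z \<in> inside ?P" | "z \<in> outside ?P" using J(3) assms(3) by blast
  then show ?thesis
  proof cases
    case 1
    have "connected_component_set (- ?P) z = inside ?P"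
    proof
      show "connected_component_set (- ?P) z \<subseteq> inside ?P" using 1 inside_same_component by fastforce
      show "inside ?P \<subseteq> connected_component_set (- ?P) z"
        by (rule connected_component_maximal[OF 1 J(1)]) (use J(3) in blast)
    qed
    then show ?thesis using J(4) by simp
  next
    case 2
    have "connected_component_set (- ?P) z = outside ?P"
    proof
      show "connected_component_set (- ?P) z \<subseteq> outside ?P" using 2 outside_same_component by fastforce
      show "outside ?P \<subseteq> connected_component_set (- ?P) z"
        by (rule connected_component_maximal[OF 2 J(2)]) (use J(3) in blast)
    qed
    then show ?thesis using J(5) by simp
  qed
qed

context disc_drawing
begin

text \<open>A triangle as a function of its vertex set, without an order of the corners, because the
  triangles to be compared arise as intersections of cliques.\<close>

definition curve :: "'a set \<Rightarrow> complex set" where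
  "curve T = (\<Union>e\<in>{e \<in> E. e \<subseteq> T}. L e)"

definition side :: "'a set \<Rightarrow> 'a \<Rightarrow> complex set" where
  "side T d = connected_component_set (- curve T) (f d)"

lemma curve_tri:
  assumes "{a, b} \<in> E" "{b, c} \<in> E" "{c, a} \<in> E"
  shows "curve {a, b, c} = tri a b c"
proof -
  have "e \<in> {{a, b}, {b, c}, {c, a}}" if "e \<in> E" "e \<subseteq> {a, b, c}" for e
    using that by (elim edgeE) auto
  then have "{e \<in> E. e \<subseteq> {a, b, c}} = {{a, b}, {b, c}, {c, a}}" using assms by blast
  then show ?thesis by (auto simp: curve_def tri_def)
qed

lemma L_Int_tri:
  assumes "{a, b} \<in> E" "{b, c} \<in> E" "{c, a} \<in> E" "{x, d} \<in> E" "d \<notin> {a, b, c}"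
  shows "L {x, d} \<inter> tri a b c \<subseteq> {f x}"
proof -
  have "L {x, d} \<inter> L e \<subseteq> {f x}" if "e \<in> E" "e \<subseteq> {a, b, c}" for e
  proof -
    have "d \<notin> e" using that(2) assms(5) by blast
    then have "L {x, d} \<inter> L e \<subseteq> f ` ({x, d} \<inter> e)" using assms(4) that(1) by (intro L_Int) auto
    also have "\<dots> \<subseteq> {f x}" using \<open>d \<notin> e\<close> by auto
    finally show ?thesis .
  qed
  then show ?thesis unfolding curve_tri[OF assms(1-3), symmetric] curve_def by blast
qed

lemma vertex_notin_tri:
  assumes "{a, b} \<in> E" "{b, c} \<in> E" "{c, a} \<in> E" "d \<in> V" "d \<notin> {a, b, c}"
  shows "f d \<notin> tri a b c"
  using vertex_in_L_iff[OF _ assms(4)] assms unfolding tri_def by auto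

text \<open>The triangle \<open>abd\<close> separates \<open>c\<close> from \<open>e\<close>, so the
  side of \<open>e\<close> avoids the edges at \<open>c\<close> and therefore the triangle
  \<open>abc\<close>. It has \<open>f d\<close> on its frontier, hence meets the open side of
  \<open>d\<close> and, being connected, lies in it. It is smaller because it does not contain
  \<open>f d\<close>.\<close>

lemma side_shrinks:
  assumes K: "{a, b} \<in> E" "{b, c} \<in> E" "{c, a} \<in> E" "{a, d} \<in> E" "{b, d} \<in> E" "{c, d} \<in> E"
    and e: "{a, e} \<in> E" "{b, e} \<in> E" "{d, e} \<in> E" "e \<noteq> c"
  shows "side {a, b, d} e \<subset> side {a, b, c} d"
proof -
  have da: "{d, a} \<in> E" and ac: "{a, c} \<in> E" and dc: "{d, c} \<in> E"
    using K by (simp_all add: insert_commute)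
  have ne: "a \<noteq> b" "b \<noteq> c" "c \<noteq> a" "a \<noteq> d" "b \<noteq> d" "c \<noteq> d" "a \<noteq> e" "b \<noteq> e" "d \<noteq> e"
    using K e edge_neq by blast+
  have V: "c \<in> V" "d \<in> V" "e \<in> V" using K e edge_in_V by blast+
  note abd = K(1,5) da
  define S where "S = side {a, b, d} e"
  define D where "D = side {a, b, c} d"
  have S: "S = connected_component_set (- tri a b d) (f e)"
    by (simp add: S_def side_def curve_tri[OF abd])
  have D: "D = connected_component_set (- tri a b c) (f d)"
    by (simp add: D_def side_def curve_tri[OF K(1-3)])
  have Ssub: "S \<subseteq> - tri a b d" and Sconn: "connected S" unfolding S by (auto simp: connected_component_subset)
  have fcS: "f c \<notin> S"
  proof
    assume "f c \<in> S"
    then have "connected_component (- tri a b d) (f c) (f e)"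
      unfolding S by (simp add: connected_component_sym)
    then show False using K5_minus_edge_separates[OF abd ac K(2) dc e(1-3)] e(4) by simp
  qed
  \<comment> \<open>Without its end on \<open>abd\<close>, the edge \<open>xc\<close> is a connected
    set off \<open>abd\<close> that contains \<open>f c\<close>; a point of \<open>S\<close> on it
    would bring \<open>f c\<close> into \<open>S\<close>.\<close>
  have SL: "S \<inter> L {x, c} = {}" if x: "x \<in> {a, b}" for x
  proof (rule ccontr)
    assume "S \<inter> L {x, c} \<noteq> {}"
    then obtain z where z: "z \<in> S" "z \<in> L {x, c}" by blast
    have xc: "{x, c} \<in> E" using x ac K(2) by blast
    have fx: "f x \<in> tri a b d" using x vertex_in_L[of x "{a, b}"] by (auto simp: tri_def)
    obtain g where g: "arc g" "pathstart g = f x" "path_image g = L {x, c}" using edge_arc[OF xc] by metis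
    have "connected (L {x, c} - {f x})" using connected_arc_minus_start[OF g(1)] g by simp
    moreover have "L {x, c} - {f x} \<subseteq> - tri a b d" using L_Int_tri[OF abd xc] ne by blast
    moreover have "z \<in> L {x, c} - {f x}" using z fx Ssub by blast
    moreover have "f x \<noteq> f c" using vertex_notin_tri[OF abd V(1)] fx ne by auto
    then have "f c \<in> L {x, c} - {f x}" using vertex_in_L[of c "{x, c}"] by simp
    ultimately have "connected_component (- tri a b d) z (f c)" unfolding connected_component_def by blast
    then have "f c \<in> S" using z(1) unfolding S by (metis connected_component_trans mem_Collect_eq)
    then show False using fcS by simp
  qed
  have Sc: "S \<subseteq> - tri a b c"
  proof -
    have "S \<inter> L {a, b} = {}" using Ssub by (auto simp: tri_def)
    then show ?thesis using SL[of a] SL[of b] by (auto simp: tri_def insert_commute)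
  qed
  obtain g where g: "simple_path g" "pathfinish g = pathstart g" "path_image g = tri a b d"
    using tri_curve[OF abd] .
  have "f e \<notin> tri a b d" using vertex_notin_tri[OF abd V(3)] ne by auto
  then have "frontier S = tri a b d" using frontier_Jordan_component[OF g(1,2), of "f e"] g(3) S by simp
  moreover have fd: "f d \<in> tri a b d" using vertex_in_L[of d "{b, d}"] by (auto simp: tri_def)
  ultimately have "f d \<in> closure S" by (auto simp: frontier_def)
  obtain h where h: "simple_path h" "path_image h = tri a b c" using tri_curve[OF K(1-3)] by metis
  then have "closed (tri a b c)" by (metis closed_simple_path_image)
  then have "open D" unfolding D by (intro open_connected_component open_Compl)
  have "f d \<notin> tri a b c" using vertex_notin_tri[OF K(1-3) V(2)] ne by auto
  then have fdD: "f d \<in> D" unfolding D by (simp add: connected_component_refl)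
  then have "D \<inter> S \<noteq> {}" using \<open>f d \<in> closure S\<close> \<open>open D\<close> open_Int_closure_eq_empty[of D S] by blast
  then obtain w where w: "w \<in> D" "w \<in> S" by blast
  have "S \<subseteq> connected_component_set (- tri a b c) w"
    using w(2) Sconn Sc by (rule connected_component_maximal)
  also have "\<dots> = D" using w(1) unfolding D by (metis connected_component_eq)
  finally have "S \<subseteq> D" .
  moreover have "f d \<notin> S" using fd Ssub by blast
  ultimately have "S \<subset> D" using fdD by blast
  then show ?thesis by (simp add: S_def D_def)
qed

text \<open>Choose a 4-clique \<open>K\<close> and a triangle \<open>T\<close> of \<open>K\<close> shared with another 4-clique so that the side of \<open>T\<close>
  containing the fourth vertex of \<open>K\<close> is minimal. A second shared triangle of \<open>K\<close> would have a smaller side.\<close>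

lemma K4_family_leaf:
  assumes \<K>: "\<K> \<subseteq> k_cliques V E 4" "\<K> \<noteq> {}"
  shows "\<exists>K\<in>\<K>. \<exists>T. \<forall>K'\<in>\<K> - {K}. card (K \<inter> K') = 3 \<longrightarrow> K \<inter> K' = T"
proof -
  have card4: "card K = 4" "finite K" and edge: "\<And>x y. x \<in> K \<Longrightarrow> y \<in> K \<Longrightarrow> x \<noteq> y \<Longrightarrow> {x, y} \<in> E"
    if "K \<in> \<K>" for K
    using \<K>(1) that finite_V unfolding k_cliques_def clique_def by (auto dest: finite_subset)
  have "finite \<K>"
    using \<K>(1) finite_V by (intro finite_subset[of \<K> "Pow V"]) (auto simp: k_cliques_def clique_def)
  define P where "P = {(K, K'). K \<in> \<K> \<and> K' \<in> \<K> \<and> K \<noteq> K' \<and> card (K \<inter> K') = 3}"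
  have diff: "\<exists>d. K - K' = {d}" if "(K, K') \<in> P" for K K'
  proof -
    have "card (K - K') = 1" using that card4[of K] by (auto simp: P_def card_Diff_subset_Int)
    then show ?thesis by (simp add: card_1_singleton_iff)
  qed
  \<comment> \<open>For a pair in \<open>P\<close> the difference is a singleton, so
    \<open>the_elem\<close> picks the vertex of the first clique outside the shared
    triangle.\<close>
  define \<sigma> where "\<sigma> x = side (fst x \<inter> snd x) (the_elem (fst x - snd x))" for x
  show ?thesis
  proof (cases "P = {}")
    case True
    then have "card (K \<inter> K') \<noteq> 3" if "K \<in> \<K>" "K' \<in> \<K> - {K}" for K K'
      using that unfolding P_def by blast
    then show ?thesis using \<K>(2) by blast
  next
    case False
    have "P \<subseteq> \<K> \<times> \<K>" by (auto simp: P_def)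
    then have "finite (\<sigma> ` P)" using \<open>finite \<K>\<close> by (meson finite_SigmaI finite_imageI finite_subset)
    then have "\<exists>m\<in>\<sigma> ` P. \<forall>b\<in>\<sigma> ` P. b \<subseteq> m \<longrightarrow> m = b"
      using False by (intro finite_has_minimal) auto
    then obtain m where m: "m \<in> \<sigma> ` P" "\<And>b. b \<in> \<sigma> ` P \<Longrightarrow> b \<subseteq> m \<Longrightarrow> m = b"
      by meson
    then obtain K K' where KK: "(K, K') \<in> P" "m = \<sigma> (K, K')" by auto
    have K: "K \<in> \<K>" "K' \<in> \<K>" "K \<noteq> K'" "card (K \<inter> K') = 3" using KK(1) by (auto simp: P_def)
    obtain d where d: "K - K' = {d}" using diff[OF KK(1)] by blast
    have "K \<inter> K'' = K \<inter> K'" if K'': "K'' \<in> \<K> - {K}" "card (K \<inter> K'') = 3" for K''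
    proof (rule ccontr)
      assume neq: "K \<inter> K'' \<noteq> K \<inter> K'"
      \<comment> \<open>The competitor of the minimal pair is the pair with \<open>K''\<close> in
        first place: its side is taken off the triangle \<open>abd\<close>, towards the vertex
        \<open>e\<close> of \<open>K''\<close> outside \<open>K\<close>.\<close>
      have P1: "(K, K'') \<in> P" and P2: "(K'', K) \<in> P" using K'' K by (auto simp: P_def Int_commute)
      obtain c where c: "K - K'' = {c}" using diff[OF P1] by blast
      obtain e where e: "K'' - K = {e}" using diff[OF P2] by blast
      have "c \<noteq> d" using neq c d by blast
      have "card (K - {c, d}) = 2" using card4[OF K(1)] c d \<open>c \<noteq> d\<close> by (subst card_Diff_subset) auto
      then obtain a b where ab: "K - {c, d} = {a, b}" "a \<noteq> b" by (auto simp: card_2_iff)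
      have memK: "c \<in> K" "d \<in> K" using c d by blast+
      have memab: "a \<in> K" "b \<in> K" "a \<noteq> c" "b \<noteq> c" "a \<noteq> d" "b \<noteq> d" using ab(1) by blast+
      have "K \<inter> K' = K - {d}" using d by blast
      also have "\<dots> = insert c (K - {c, d})" using memK \<open>c \<noteq> d\<close> by blast
      finally have T: "K \<inter> K' = {a, b, c}" by (simp only: ab(1) insert_commute)
      have "K'' \<inter> K = K - {c}" using c by blast
      also have "\<dots> = insert d (K - {c, d})" using memK \<open>c \<noteq> d\<close> by blast
      finally have T': "K'' \<inter> K = {a, b, d}" by (simp only: ab(1) insert_commute)
      have memK'': "a \<in> K''" "b \<in> K''" "d \<in> K''" using T' by blast+
      have "e \<in> K''" "e \<notin> K" using e by blast+
      then have ne: "a \<noteq> e" "b \<noteq> e" "d \<noteq> e" "e \<noteq> c" using memK memab by blast+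
      have K''K: "K'' \<in> \<K>" using K''(1) by blast
      have "{a, b} \<in> E" "{b, c} \<in> E" "{c, a} \<in> E" "{a, d} \<in> E" "{b, d} \<in> E" "{c, d} \<in> E"
        by (rule edge[OF K(1)]; use memK memab ab(2) \<open>c \<noteq> d\<close> in simp)+
      moreover have "{a, e} \<in> E" "{b, e} \<in> E" "{d, e} \<in> E"
        by (rule edge[OF K''K]; use memK'' ne \<open>e \<in> K''\<close> in simp)+
      ultimately have "side {a, b, d} e \<subset> side {a, b, c} d"
        using ne(4) by (rule side_shrinks)
      moreover have "\<sigma> (K'', K) = side {a, b, d} e" by (simp add: \<sigma>_def T' e)
      moreover have "m = side {a, b, c} d" by (simp add: KK(2) \<sigma>_def T d)
      ultimately show False using m(2)[of "\<sigma> (K'', K)"] P2 by blast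
    qed
    then show ?thesis using K(1) by blast
  qed
qed

end

section \<open>Planarity of the token sliding graphs\<close>

lemma finite_k_cliques:
  assumes "finite V"
  shows "finite (k_cliques V E k)"
  by (rule finite_subset[of _ "Pow V"]) (use assms in \<open>auto simp: k_cliques_def clique_def\<close>)

lemma TS_edgesE:
  assumes "ee \<in> TS_edges V E k"
  obtains C C' u v where "ee = {C, C'}" "C \<in> k_cliques V E k" "C' \<in> k_cliques V E k"
    "C - C' = {u}" "C' - C = {v}" "{u, v} \<in> E"
proof -
  obtain C C' where C: "ee = {C, C'}" "C \<in> k_cliques V E k" "C' \<in> k_cliques V E k"
    and "\<exists>u v. C - C' = {u} \<and> C' - C = {v} \<and> {u, v} \<in> E"
    using assms unfolding TS_edges_def mem_Collect_eq by metis
  then obtain u v where uv: "C - C' = {u}" "C' - C = {v}" "{u, v} \<in> E" by (elim exE conjE)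
  show ?thesis by (rule that[OF C uv])
qed

text \<open>The only pair of vertices of the union that lies in neither clique is \<open>u\<close>,
  \<open>v\<close>, and the sliding rule makes it an edge.\<close>

lemma TS_edges_union_clique:
  assumes V: "finite V" and C: "C \<in> k_cliques V E k" "C' \<in> k_cliques V E k"
    and uv: "C - C' = {u}" "C' - C = {v}" "{u, v} \<in> E"
  shows "C \<union> C' \<in> k_cliques V E (Suc k)"
proof -
  have cl: "C \<subseteq> V" "C' \<subseteq> V" "card C = k"
    "\<And>x y. x \<in> C \<Longrightarrow> y \<in> C \<Longrightarrow> x \<noteq> y \<Longrightarrow> {x, y} \<in> E" "\<And>x y. x \<in> C' \<Longrightarrow> y \<in> C' \<Longrightarrow> x \<noteq> y \<Longrightarrow> {x, y} \<in> E"
    using C by (auto simp: k_cliques_def clique_def)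
  have "C \<union> C' = insert v C" "v \<notin> C" using uv(2) by blast+
  moreover have "finite C" using cl(1) V finite_subset by blast
  ultimately have "card (C \<union> C') = Suc k" using cl(3) by simp
  moreover have "{x, y} \<in> E" if xy: "x \<in> C \<union> C'" "y \<in> C \<union> C'" "x \<noteq> y" for x y
  proof -
    consider "x \<in> C" "y \<in> C" | "x \<in> C'" "y \<in> C'" | "x \<in> C - C'" "y \<in> C' - C" | "x \<in> C' - C" "y \<in> C - C'"
      using xy by blast
    then show ?thesis
    proof cases
      case 1 then show ?thesis using cl(4) xy(3) by blast
    next
      case 2 then show ?thesis using cl(5) xy(3) by blast
    next
      case 3 then show ?thesis using uv by simp
    next
      case 4 then show ?thesis using uv by (simp add: insert_commute)
    qed
  qed
  ultimately show ?thesis using cl(1,2) unfolding k_cliques_def clique_def by blast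
qed

text \<open>This is the forest of K4's with no member.\<close>

lemma planar_no_edges:
  fixes V :: "'a set"
  assumes "finite V"
  shows "planar V {}"
proof -
  have "\<exists>f. straight_drawing f V (\<Union>Q\<in>{}. pairs Q)"
    by (rule straight_drawing_K4_forest[OF assms]) simp_all
  then obtain f :: "'a \<Rightarrow> complex" where "straight_drawing f V {}" by auto
  then show ?thesis by (rule straight_drawing_imp_planar) simp
qed

text \<open>Union takes an edge \<open>{{u}, {v}}\<close> back to the edge \<open>{u, v}\<close> of
  the given graph, whose arc is reused unchanged.\<close>

lemma planar_TS_1:
  fixes V :: "'a set"
  assumes "planar V E"
  shows "planar (k_cliques V E 1) (TS_edges V E 1)"
proof -
  obtain f :: "'a \<Rightarrow> complex" and \<gamma> :: "'a set \<Rightarrow> real \<Rightarrow> complex" where f: "inj_on f V"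
    "\<And>e. e \<in> E \<Longrightarrow> arc (\<gamma> e) \<and> {pathstart (\<gamma> e), pathfinish (\<gamma> e)} = f ` e \<and> path_image (\<gamma> e) \<inter> f ` V = f ` e"
    "\<And>e e'. e \<in> E \<Longrightarrow> e' \<in> E \<Longrightarrow> e \<noteq> e' \<Longrightarrow> path_image (\<gamma> e) \<inter> path_image (\<gamma> e') \<subseteq> f ` (e \<inter> e')"
    using assms unfolding planar_def by metis
  have V1: "k_cliques V E 1 = (\<lambda>v. {v}) ` V"
    by (auto simp: k_cliques_def clique_def card_1_singleton_iff)
  have E1: "\<exists>u v. ee = {{u}, {v}} \<and> {u, v} \<in> E" if ee: "ee \<in> TS_edges V E 1" for ee
  proof -
    obtain C C' u v where C: "ee = {C, C'}" "C \<in> k_cliques V E 1" "C' \<in> k_cliques V E 1"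
      "C - C' = {u}" "C' - C = {v}" "{u, v} \<in> E"
      using TS_edgesE[OF ee] .
    then have "C = {u}" "C' = {v}" unfolding V1 by auto
    then show ?thesis using C by blast
  qed
  have U: "\<Union>ee \<in> E" "ee = (\<lambda>v. {v}) ` \<Union>ee" if ee: "ee \<in> TS_edges V E 1" for ee
  proof -
    obtain u v where uv: "ee = {{u}, {v}}" "{u, v} \<in> E" using E1[OF ee] by (elim exE conjE)
    have "\<Union>ee = {u, v}" by (simp add: uv(1) insert_commute)
    then show "\<Union>ee \<in> E" "ee = (\<lambda>v. {v}) ` \<Union>ee" using uv by simp_all
  qed
  define F where "F C = f (the_elem C)" for C
  have F: "F ` (\<lambda>v. {v}) ` A = f ` A" for A by (simp add: F_def image_image)
  have FU: "F ` ee = f ` \<Union>ee" if "ee \<in> TS_edges V E 1" for ee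
    using F[of "\<Union>ee"] U(2)[OF that] by simp
  show ?thesis
    unfolding planar_def
  proof (intro exI[of _ F] exI[of _ "\<lambda>ee. \<gamma> (\<Union>ee)"] conjI ballI impI)
    show "inj_on F (k_cliques V E 1)" unfolding V1 using f(1) by (auto simp: F_def inj_on_def)
    fix ee assume ee: "ee \<in> TS_edges V E 1"
    show "arc (\<gamma> (\<Union>ee))" using f(2)[OF U(1)[OF ee]] by blast
    show "{pathstart (\<gamma> (\<Union>ee)), pathfinish (\<gamma> (\<Union>ee))} = F ` ee"
      using f(2)[OF U(1)[OF ee]] FU[OF ee] by simp
    show "path_image (\<gamma> (\<Union>ee)) \<inter> F ` k_cliques V E 1 = F ` ee"
      unfolding V1 F FU[OF ee] using f(2)[OF U(1)[OF ee]] by blast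
    fix ee' assume ee': "ee' \<in> TS_edges V E 1" "ee \<noteq> ee'"
    note U2 = U(2)[OF ee, symmetric] U(2)[OF ee'(1), symmetric]
    have "\<Union>ee \<noteq> \<Union>ee'"
    proof
      assume "\<Union>ee = \<Union>ee'"
      then have "(\<lambda>v. {v}) ` \<Union>ee = (\<lambda>v. {v}) ` \<Union>ee'" by (rule arg_cong)
      then show False using ee'(2) by (simp only: U2)
    qed
    then have "path_image (\<gamma> (\<Union>ee)) \<inter> path_image (\<gamma> (\<Union>ee')) \<subseteq> f ` (\<Union>ee \<inter> \<Union>ee')"
      by (rule f(3)[OF U(1)[OF ee] U(1)[OF ee'(1)]])
    also have "\<dots> = F ` (\<lambda>v. {v}) ` (\<Union>ee \<inter> \<Union>ee')" by (simp only: F)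
    also have "\<dots> \<subseteq> F ` (ee \<inter> ee')"
    proof (intro image_mono subsetI)
      fix s assume "s \<in> (\<lambda>v. {v}) ` (\<Union>ee \<inter> \<Union>ee')"
      then have "s \<in> (\<lambda>v. {v}) ` \<Union>ee" "s \<in> (\<lambda>v. {v}) ` \<Union>ee'" by blast+
      then show "s \<in> ee \<inter> ee'" by (simp only: U2 Int_iff)
    qed
    finally show "path_image (\<gamma> (\<Union>ee)) \<inter> path_image (\<gamma> (\<Union>ee')) \<subseteq> F ` (ee \<inter> ee')" .
  qed
qed

context disc_drawing
begin

lemma planar_TS_3: "planar (k_cliques V E 3) (TS_edges V E 3)"
proof -
  \<comment> \<open>Any two triangles of a 4-clique differ by sliding one token along an edge, so a
    block is the vertex set of one of the K4's.\<close>
  define block where "block K = {T. T \<subseteq> K \<and> card T = 3}" for K :: "'a set"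
  let ?K4 = "k_cliques V E 4"
  have sub: "block K \<subseteq> k_cliques V E 3" "card (block K) = 4" if "K \<in> ?K4" for K
  proof -
    have K: "K \<subseteq> V" "card K = 4" "finite K"
      using that finite_V by (auto simp: k_cliques_def clique_def dest: finite_subset)
    show "block K \<subseteq> k_cliques V E 3"
      using that by (force simp: block_def k_cliques_def clique_def)
    have "card (block K) = 4 choose 3" using n_subsets[OF K(3), of 3] K(2) by (simp add: block_def)
    then show "card (block K) = 4" by (simp add: numeral_eq_Suc)
  qed
  \<comment> \<open>A family of blocks is pulled back to a family of 4-cliques. A triangle common to
    two distinct 4-cliques is their whole intersection, and \<open>K4_family_leaf\<close> makes it
    the same one for all partners of \<open>K\<close>.\<close>
  have leaf: "\<exists>Q\<in>\<R>. \<exists>T. \<forall>Q'\<in>\<R> - {Q}. Q \<inter> Q' \<subseteq> {T}" if \<R>: "\<R> \<subseteq> block ` ?K4" "\<R> \<noteq> {}" for \<R>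
  proof -
    define \<K> where "\<K> = {K \<in> ?K4. block K \<in> \<R>}"
    have "\<K> \<subseteq> ?K4" "\<K> \<noteq> {}" using \<R> by (auto simp: \<K>_def)
    then obtain K T where K: "K \<in> \<K>" "\<And>K'. K' \<in> \<K> - {K} \<Longrightarrow> card (K \<inter> K') = 3 \<Longrightarrow> K \<inter> K' = T"
      using K4_family_leaf by metis
    have card4: "card K' = 4" "finite K'" if "K' \<in> \<K>" for K'
      using that finite_V by (auto simp: \<K>_def k_cliques_def clique_def dest: finite_subset)
    have "block K \<inter> Q' \<subseteq> {T}" if Q': "Q' \<in> \<R> - {block K}" for Q'
    proof -
      obtain K' where K': "K' \<in> \<K> - {K}" "Q' = block K'" using Q' \<R>(1) by (auto simp: \<K>_def)
      have "T' = T" if T': "T' \<subseteq> K" "T' \<subseteq> K'" "card T' = 3" for T'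
      proof -
        have fin: "finite (K \<inter> K')" using card4[OF K(1)] by simp
        have "K \<inter> K' \<noteq> K"
        proof
          assume "K \<inter> K' = K"
          then have "K = K'" using card4[OF K(1)] card4[of K'] K'(1) by (intro card_subset_eq) auto
          then show False using K'(1) by blast
        qed
        then have "card (K \<inter> K') < card K" using card4[OF K(1)] by (intro psubset_card_mono) auto
        moreover have "3 \<le> card (K \<inter> K')" using card_mono[OF fin, of T'] T' by auto
        ultimately have 3: "card (K \<inter> K') = 3" using card4[OF K(1)] by linarith
        then have "T' = K \<inter> K'" using T' fin by (intro card_subset_eq) auto
        then show ?thesis using K(2)[OF K'(1) 3] by simp
      qed
      then show ?thesis by (auto simp: K'(2) block_def)
    qed
    moreover have "block K \<in> \<R>" using K(1) by (simp add: \<K>_def)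
    ultimately show ?thesis by blast
  qed
  have "\<exists>f. straight_drawing f (k_cliques V E 3) (\<Union>Q\<in>block ` ?K4. pairs Q)"
  proof (rule straight_drawing_K4_forest)
    show "finite (k_cliques V E 3)" "finite (block ` ?K4)" using finite_V by (simp_all add: finite_k_cliques)
    show "Q \<subseteq> k_cliques V E 3 \<and> card Q = 4" if "Q \<in> block ` ?K4" for Q using that sub by blast
  qed (fact leaf)
  then obtain f where f: "straight_drawing f (k_cliques V E 3) (\<Union>Q\<in>block ` ?K4. pairs Q)" by blast
  have edge: "(\<exists>C C'. C \<in> k_cliques V E 3 \<and> C' \<in> k_cliques V E 3 \<and> C \<noteq> C' \<and> ee = {C, C'}) \<and>
      ee \<in> (\<Union>Q\<in>block ` ?K4. pairs Q)" if ee: "ee \<in> TS_edges V E 3" for ee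
  proof -
    obtain C C' u v where C: "ee = {C, C'}" "C \<in> k_cliques V E 3" "C' \<in> k_cliques V E 3"
      "C - C' = {u}" "C' - C = {v}" "{u, v} \<in> E"
      using TS_edgesE[OF ee] .
    \<comment> \<open>Adjacent triangles span a 4-clique, and its block contains both of
      them.\<close>
    have "C \<union> C' \<in> k_cliques V E (Suc 3)" by (rule TS_edges_union_clique[OF finite_V C(2-6)])
    then have "C \<union> C' \<in> ?K4" by simp
    moreover have "C \<noteq> C'" using C(4) by auto
    then have "ee \<in> pairs (block (C \<union> C'))" using C(1-3) by (auto simp: pairs_def block_def k_cliques_def)
    ultimately show ?thesis using C(1-3) \<open>C \<noteq> C'\<close> by blast
  qed
  have "straight_drawing f (k_cliques V E 3) (TS_edges V E 3)"
    using f by (rule straight_drawing_subset) (use edge in blast)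
  then show ?thesis by (rule straight_drawing_imp_planar) (use edge in blast)
qed

end

lemma TS_edges_empty:
  assumes "finite V" "clique_number V E \<le> k"
  shows "TS_edges V E k = {}"
proof (rule ccontr)
  assume "TS_edges V E k \<noteq> {}"
  then obtain ee where "ee \<in> TS_edges V E k" by blast
  then obtain C C' u v where "C \<in> k_cliques V E k" "C' \<in> k_cliques V E k" "C - C' = {u}" "C' - C = {v}" "{u, v} \<in> E"
    by (rule TS_edgesE)
  then have "C \<union> C' \<in> k_cliques V E (Suc k)" by (rule TS_edges_union_clique[OF assms(1)])
  then have "clique V E (C \<union> C')" "Suc k = card (C \<union> C')" by (simp_all add: k_cliques_def)
  then have "Suc k \<in> {card C |C. clique V E C}" by blast
  moreover have "finite {card C |C. clique V E C}"
    by (rule finite_subset[of _ "card ` Pow V"]) (use assms(1) in \<open>auto simp: clique_def\<close>)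
  ultimately have "Suc k \<le> clique_number V E" unfolding clique_number_def by (rule Max_ge[rotated])
  then show False using assms(2) by simp
qed

theorem theorem5p1:
  fixes V :: "'a set" and E :: "'a set set" and k :: nat
  assumes "simple_graph V E"
    and "planar V E"
    and "1 \<le> k" and "k \<le> clique_number V E" and "clique_number V E \<le> 4"
  shows "planar (k_cliques V E k) (TS_edges V E k)"
proof -
  obtain f r M p where "disc_drawing V E f r M p"
    using planar_imp_disc_drawing[OF assms(1,2)] by blast
  then interpret disc_drawing V E f r M p .
  consider "k = 1" | "k = 2" | "k = 3" | "k = 4" using assms(3-5) by linarith
  then show ?thesis
  proof cases
    case 1 then show ?thesis using planar_TS_1[OF assms(2)] by simp
  next
    case 2 then show ?thesis using planar_TS_2 by simp
  next
    case 3 then show ?thesis using planar_TS_3 by simp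
  next
    case 4
    then show ?thesis
      using TS_edges_empty[OF finite_V assms(5)] planar_no_edges[OF finite_k_cliques[OF finite_V, of E 4]]
      by simp
  qed
qed

end
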